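(* For all $x,y\in\mathbf{S}_+$: $$\Delta_\prec(x\prec y)=x'_\prec\prec y'\otimes x''_\prec\star y''+x\otimes y+x\prec y'\otimes y''+x'_\prec\otimes x''_\prec\star y+x'_\prec\prec y\otimes x''_\prec,$$ $$\Delta_\succ(x\prec y)=x'_\succ\prec y'\otimes x''_\succ\star y''+x'_\succ\prec y\otimes x''_\succ+x'_\succ\otimes x''_\succ\star y,$$ $$\Delta_\prec(x\succ y)=x'_\prec\succ y'\otimes x''_\prec\star y''+x'_\prec\succ y\otimes x''_\prec+x\succ y'\otimes y'',$$ $$\Delta_\succ(x\succ y)=x'_\succ\succ y'\otimes x''_\succ\star y''+y\otimes x+y'\otimes x\star y''+x'_\succ\succ y\otimes x''_\succ.$$ Consequently, $(\mathbf{S}_+,\succ^{op},\prec^{op},\Delta_\succ^{op},\Delta_\prec^{op})$ is a bidendriform bialgebra.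
   Context: The ground field is $\mathbf{Q}$, $\mathbb{N}^*=\{1,2,\dots\}$, $[k]=\{1,\dots,k\}$. Graded permutations: $\mathbf{S}$ is the vector space with basis the pairs $(\sigma,d)$, $\sigma\in\mathfrak{S}_k$, $d:[k]\to\mathbb{N}^*$, $k\ge 0$; $(\sigma,d)$ is written as the biword $\begin{pmatrix}\sigma(1)&\ldots&\sigma(k)\\ d(1)&\ldots&d(k)\end{pmatrix}$. $\mathbf{S}_+$ is the span of the biwords with $k\ge 1$. For $(\sigma,d)$ of length $k\ge1$ and $(\tau,e)$ of length $l\ge1$, $$(\sigma,d)\prec(\tau,e)=\sum_{\alpha}((\sigma\otimes\tau)\circ\alpha^{-1},(d\otimes e)\circ\alpha^{-1}),$$ the sum being over permutations $\alpha\in\mathfrak{S}_{k+l}$ with $\alpha(1)<\dots<\alpha(k)$, $\alpha(k+1)<\dots<\alpha(k+l)$ and $\alpha^{-1}(1)=1$; $(\sigma,d)\succ(\tau,e)$ is the same sum with $\alpha^{-1}(1)=k+1$ instead. Here $(\sigma\otimes\tau)(i)=\sigma(i)$ for $i\le k$, $(\sigma\otimes\tau)(i)=\tau(i-k)+k$ for $i>k$, and $(d\otimes e)(i)=d(i)$ for $i\le k$, $(d\otimes e)(i)=e(i-k)$ for $i>k$. Put $\star=\prec+\succ$ on $\mathbf{S}_+$. Coproducts on $\mathbf{S}_+$: for $(\sigma,d)$ with $\sigma\in\mathfrak{S}_n$, $n\ge1$, $$\Delta_\prec((\sigma,d))=\sum_{i=\sigma^{-1}(1)}^{n-1}\begin{pmatrix}std(\sigma(1),\ldots,\sigma(i))\\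 d(1),\ldots,d(i)\end{pmatrix}\otimes\begin{pmatrix}std(\sigma(i+1),\ldots,\sigma(n))\\ d(i+1),\ldots,d(n)\end{pmatrix},$$ and $\Delta_\succ((\sigma,d))$ is the same sum over $1\le i\le\sigma^{-1}(1)-1$. Here $std(i_1,\dots,i_k)=(f(i_1),\dots,f(i_k))$, $f$ being the increasing bijection $\{i_1,\dots,i_k\}\to[k]$. Sweedler-type notation (summation understood): $\Delta_\prec(x)=x'_\prec\otimes x''_\prec$, $\Delta_\succ(x)=x'_\succ\otimes x''_\succ$, $\tilde\Delta(x)=\Delta_\prec(x)+\Delta_\succ(x)=x'\otimes x''$. In each term the products bind more tightly than $\otimes$. Opposites: $a\prec^{op}b=b\prec a$, $a\succ^{op}b=b\succ a$, and $\Delta_\prec^{op},\Delta_\succ^{op}$ are $\Delta_\prec,\Delta_\succ$ followed by the flip. Bidendriform bialgebra: a tuple $(A,\prec,\succ,\Delta_\prec,\Delta_\succ)$ (products and coproducts listed in this order), with bilinear products $A\otimes A\to A$ and linear coproducts $A\to A\otimes A$, such that, writing $ab=a\prec b+a\succ b$ and $\tilde\Delta=\Delta_\prec+\Delta_\succ$, with the same Sweedler notation: (i) (dendriform algebra) $(a\prec b)\prec c=a\prec(bc)$, $(a\succ b)\prec c=a\succ(b\prec c)$, $(ab)\succ c=a\succ(b\succ c)$; (ii) (dendriform coalgebra) $(\Delta_\prec\otimes Id)\Delta_\prec=(Id\otimes\tilde\Delta)\Delta_\prec$, $(\Delta_\succ\otimes Id)\Delta_\prec=(Id\otimes\Delta_\prec)\Delta_\succ$,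 $(\tilde\Delta\otimes Id)\Delta_\succ=(Id\otimes\Delta_\succ)\Delta_\succ$; (iii) (compatibilities) $\Delta_\succ(a\succ b)=a'b'_\succ\otimes a''\succ b''_\succ+a'\otimes a''\succ b+b'_\succ\otimes a\succ b''_\succ+ab'_\succ\otimes b''_\succ+a\otimes b$, $\Delta_\succ(a\prec b)=a'b'_\succ\otimes a''\prec b''_\succ+a'\otimes a''\prec b+b'_\succ\otimes a\prec b''_\succ$, $\Delta_\prec(a\succ b)=a'b'_\prec\otimes a''\succ b''_\prec+ab'_\prec\otimes b''_\prec+b'_\prec\otimes a\succ b''_\prec$, $\Delta_\prec(a\prec b)=a'b'_\prec\otimes a''\prec b''_\prec+a'b\otimes a''+b'_\prec\otimes a\prec b''_\prec+b\otimes a$. *)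

theory Defs
  imports Complex_Main "HOL-Library.Poly_Mapping" "HOL-Combinatorics.Permutations"
begin

section \<open>Vector spaces over the rationals\<close>

class rat_vector = ab_group_add +
  fixes scaleQ :: "rat \<Rightarrow> 'a \<Rightarrow> 'a"  (infixr \<open>*\<^sub>Q\<close> 75)
  assumes scaleQ_add_right: "c *\<^sub>Q (x + y) = c *\<^sub>Q x + c *\<^sub>Q y"
    and scaleQ_add_left: "(c + d) *\<^sub>Q x = c *\<^sub>Q x + d *\<^sub>Q x"
    and scaleQ_scaleQ: "c *\<^sub>Q d *\<^sub>Q x = (c * d) *\<^sub>Q x"
    and scaleQ_one: "1 *\<^sub>Q x = x"

global_interpretation rat_vector: vector_space "scaleQ :: rat \<Rightarrow> 'a \<Rightarrow> 'a::rat_vector"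
  by unfold_locales (simp_all add: scaleQ_add_right scaleQ_add_left scaleQ_scaleQ scaleQ_one)

abbreviation linearQ :: "('a::rat_vector \<Rightarrow> 'b::rat_vector) \<Rightarrow> bool"
  where "linearQ \<equiv> Vector_Spaces.linear scaleQ scaleQ"

definition bilinearQ :: "('a::rat_vector \<Rightarrow> 'b::rat_vector \<Rightarrow> 'c::rat_vector) \<Rightarrow> bool"
  where "bilinearQ f \<longleftrightarrow> (\<forall>x. linearQ (f x)) \<and> (\<forall>y. linearQ (\<lambda>x. f x y))"

lemma linearQ_iff:
  "linearQ f \<longleftrightarrow> (\<forall>x y. f (x + y) = f x + f y) \<and> (\<forall>c x. f (c *\<^sub>Q x) = c *\<^sub>Q f x)"
  by (auto simp: Vector_Spaces.linear_iff rat_vector.vector_space_axioms)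

instantiation rat :: rat_vector
begin
definition scaleQ_rat_def [simp]: "c *\<^sub>Q (x::rat) = c * x"
instance by standard (simp_all add: algebra_simps)
end

instantiation poly_mapping :: (type, rat_vector) rat_vector
begin

definition "c *\<^sub>Q p = Poly_Mapping.map (scaleQ c) p"

lemma lookup_scaleQ [simp]:
  "Poly_Mapping.lookup (c *\<^sub>Q p) k = c *\<^sub>Q Poly_Mapping.lookup p k"
  by (simp add: scaleQ_poly_mapping_def map.rep_eq when_def)

instance
  by standard
    (auto intro!: poly_mapping_eqI
      simp: lookup_add scaleQ_add_right scaleQ_add_left scaleQ_scaleQ scaleQ_one)

end

text \<open>The type \<^typ>\<open>'b \<Rightarrow>\<^sub>0 rat\<close> is the rational vector space with basis \<^typ>\<open>'b\<close>.\<close>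

abbreviation basis_vec :: "'b \<Rightarrow> ('b \<Rightarrow>\<^sub>0 rat)"
  where "basis_vec b \<equiv> Poly_Mapping.single b 1"

definition lin_ext :: "('b \<Rightarrow> 'v::rat_vector) \<Rightarrow> ('b \<Rightarrow>\<^sub>0 rat) \<Rightarrow> 'v"
  where "lin_ext f x = (\<Sum>b\<in>Poly_Mapping.keys x. Poly_Mapping.lookup x b *\<^sub>Q f b)"

lemma lin_ext_superset:
  assumes "finite B" "Poly_Mapping.keys x \<subseteq> B"
  shows "lin_ext f x = (\<Sum>b\<in>B. Poly_Mapping.lookup x b *\<^sub>Q f b)"
  unfolding lin_ext_def
  by (rule sum.mono_neutral_left) (use assms in \<open>auto simp: in_keys_iff\<close>)

lemma lin_ext_basis_vec [simp]: "lin_ext f (basis_vec b) = f b"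
  by (simp add: lin_ext_def)

lemma linearQ_lin_ext: "linearQ (lin_ext f)"
proof -
  have "lin_ext f (x + y) = lin_ext f x + lin_ext f y" for x y
  proof -
    let ?B = "Poly_Mapping.keys x \<union> Poly_Mapping.keys y"
    have "Poly_Mapping.keys (x + y) \<subseteq> ?B"
      by (rule Poly_Mapping.keys_add)
    then show ?thesis
      by (simp add: lin_ext_superset[where B = ?B] lookup_add scaleQ_add_left sum.distrib)
  qed
  moreover have "lin_ext f (c *\<^sub>Q x) = c *\<^sub>Q lin_ext f x" for c x
  proof -
    have "Poly_Mapping.keys (c *\<^sub>Q x) \<subseteq> Poly_Mapping.keys x"
      by (auto simp: in_keys_iff)
    then show ?thesis
      by (simp add: lin_ext_superset[where B = "Poly_Mapping.keys x"] scaleQ_scaleQ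
          rat_vector.scale_sum_right)
  qed
  ultimately show ?thesis
    by (simp add: linearQ_iff)
qed

lemma linearQ_sum:
  assumes "linearQ f"
  shows "f (\<Sum>i\<in>I. g i) = (\<Sum>i\<in>I. f (g i))"
proof -
  have "f 0 = 0"
    using assms unfolding linearQ_iff by (metis add_cancel_right_right)
  then show ?thesis
    using assms unfolding linearQ_iff
    by (induction I rule: infinite_finite_induct) auto
qed

lemma basis_vec_expansion:
  "x = (\<Sum>b\<in>Poly_Mapping.keys x. Poly_Mapping.lookup x b *\<^sub>Q basis_vec b)"
  by (rule poly_mapping_eqI) (simp add: lookup_sum lookup_single when_def in_keys_iff if_distrib cong: if_cong)

lemma linearQ_eq_on_basis:
  assumes "linearQ f" "linearQ g" "\<And>b. f (basis_vec b) = g (basis_vec b)"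
  shows "f x = g x"
proof -
  have "h x = (\<Sum>b\<in>Poly_Mapping.keys x. Poly_Mapping.lookup x b *\<^sub>Q h (basis_vec b))"
    if "linearQ h" for h
    using that
    by (subst basis_vec_expansion, subst linearQ_sum) (simp_all add: linearQ_iff)
  from this[OF assms(1)] this[OF assms(2)] show ?thesis
    by (simp add: assms(3))
qed


section \<open>Tensor products\<close>

definition tensor_relators :: "('a::rat_vector \<times> 'b::rat_vector \<Rightarrow>\<^sub>0 rat) set"
  where "tensor_relators =
    {basis_vec (a + a', b) - basis_vec (a, b) - basis_vec (a', b) | a a' b. True} \<union>
    {basis_vec (a, b + b') - basis_vec (a, b) - basis_vec (a, b') | a b b'. True} \<union>
    {basis_vec (c *\<^sub>Q a, b) - c *\<^sub>Q basis_vec (a, b) | c a b. True} \<union>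
    {basis_vec (a, c *\<^sub>Q b) - c *\<^sub>Q basis_vec (a, b) | c a b. True}"

definition tensor_rel ::
    "('a::rat_vector \<times> 'b::rat_vector \<Rightarrow>\<^sub>0 rat) \<Rightarrow> ('a \<times> 'b \<Rightarrow>\<^sub>0 rat) \<Rightarrow> bool"
  where "tensor_rel s t \<longleftrightarrow> s - t \<in> rat_vector.span tensor_relators"

lemma equivp_tensor_rel: "equivp tensor_rel"
proof (rule equivpI)
  show "reflp tensor_rel"
    by (simp add: reflp_def tensor_rel_def rat_vector.span_zero)
  show "symp tensor_rel"
    by (metis minus_diff_eq rat_vector.span_neg sympI tensor_rel_def)
  show "transp tensor_rel"
    by (rule transpI, unfold tensor_rel_def, drule (1) rat_vector.span_add) simp
qed

quotient_type (overloaded) ('a, 'b) tensor  (infixr \<open>\<otimes>\<close> 21) =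
  "('a::rat_vector \<times> 'b::rat_vector) \<Rightarrow>\<^sub>0 rat" / tensor_rel
  by (rule equivp_tensor_rel)

instantiation tensor :: (rat_vector, rat_vector) rat_vector
begin

lift_definition zero_tensor :: "'a \<otimes> 'b" is 0 .

lift_definition plus_tensor :: "('a \<otimes> 'b) \<Rightarrow> ('a \<otimes> 'b) \<Rightarrow> ('a \<otimes> 'b)" is "(+)"
  by (unfold tensor_rel_def, drule (1) rat_vector.span_add) (simp add: algebra_simps)

lift_definition uminus_tensor :: "('a \<otimes> 'b) \<Rightarrow> ('a \<otimes> 'b)" is uminus
  by (unfold tensor_rel_def, drule rat_vector.span_neg) (simp add: algebra_simps)

lift_definition minus_tensor :: "('a \<otimes> 'b) \<Rightarrow> ('a \<otimes> 'b) \<Rightarrow> ('a \<otimes> 'b)" is "(-)"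
  by (unfold tensor_rel_def, drule (1) rat_vector.span_diff) (simp add: algebra_simps)

lift_definition scaleQ_tensor :: "rat \<Rightarrow> ('a \<otimes> 'b) \<Rightarrow> ('a \<otimes> 'b)" is scaleQ
  by (unfold tensor_rel_def, drule rat_vector.span_scale)
    (simp add: rat_vector.scale_right_diff_distrib)

instance
  by standard
    (transfer; simp add: tensor_rel_def rat_vector.span_zero algebra_simps
       scaleQ_add_right scaleQ_add_left scaleQ_scaleQ scaleQ_one)+

end

lift_definition tensor :: "'a::rat_vector \<Rightarrow> 'b::rat_vector \<Rightarrow> 'a \<otimes> 'b"  (infixr \<open>\<otimes>\<close> 68)
  is "\<lambda>a b. basis_vec (a, b)" .

text \<open>
  The linear map on a tensor product induced by a bilinear map. With \<open>t = t' \<otimes> t''\<close> in Sweedler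
  notation (summation understood), \<open>tensor_lift (\<lambda>t' t''. f t' t'') t\<close> is \<open>f t' t''\<close>.
  The value is unspecified if \<open>f\<close> is not bilinear.
\<close>

definition tensor_lift ::
    "('a::rat_vector \<Rightarrow> 'b::rat_vector \<Rightarrow> 'c::rat_vector) \<Rightarrow> ('a \<otimes> 'b) \<Rightarrow> 'c"
  where "tensor_lift f = (THE g. linearQ g \<and> (\<forall>a b. g (a \<otimes> b) = f a b))"

lemma bilinearQ_tensor: "bilinearQ (tensor :: 'a::rat_vector \<Rightarrow> 'b::rat_vector \<Rightarrow> 'a \<otimes> 'b)"
proof -
  have "(a \<otimes> (b + b') :: 'a \<otimes> 'b) = a \<otimes> b + a \<otimes> b'"
    and "((a + a') \<otimes> b :: 'a \<otimes> 'b) = a \<otimes> b + a' \<otimes> b"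
    and "(a \<otimes> (c *\<^sub>Q b) :: 'a \<otimes> 'b) = c *\<^sub>Q (a \<otimes> b)"
    and "((c *\<^sub>Q a) \<otimes> b :: 'a \<otimes> 'b) = c *\<^sub>Q (a \<otimes> b)" for a a' :: 'a and b b' :: 'b and c
    by (transfer, unfold tensor_rel_def diff_diff_eq[symmetric],
        rule rat_vector.span_base, unfold tensor_relators_def, blast)+
  then show ?thesis
    by (simp add: bilinearQ_def linearQ_iff)
qed

lemma linearQ_eq_on_tensors:
  assumes "linearQ f" "linearQ g" "\<And>a b. f (a \<otimes> b) = g (a \<otimes> b)"
  shows "f t = g t"
proof -
  have lin: "linearQ (\<lambda>s. h (abs_tensor s))" if "linearQ h" for h :: "('a \<otimes> 'b) \<Rightarrow> 'c"
    using that by (simp add: linearQ_iff plus_tensor.abs_eq[symmetric] scaleQ_tensor.abs_eq[symmetric])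
  have "f (abs_tensor s) = g (abs_tensor s)" for s
  proof (rule linearQ_eq_on_basis[OF lin[OF assms(1)] lin[OF assms(2)]])
    show "f (abs_tensor (basis_vec p)) = g (abs_tensor (basis_vec p))" for p
      using assms(3)[of "fst p" "snd p"] by (simp add: tensor.abs_eq)
  qed
  then show ?thesis
    by (metis Quotient_tensor Quotient_abs_rep)
qed

lemma tensor_lift_ex1:
  fixes f :: "'a::rat_vector \<Rightarrow> 'b::rat_vector \<Rightarrow> 'c::rat_vector"
  assumes f: "bilinearQ f"
  shows "\<exists>!g. linearQ g \<and> (\<forall>a b. g (a \<otimes> b) = f a b)"
proof -
  define h where "h = lin_ext (\<lambda>(a, b). f a b)"
  have h: "linearQ h" and h_basis: "h (basis_vec (a, b)) = f a b" for a b
    by (simp_all add: h_def linearQ_lin_ext)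
  have h_diff: "h (s - t) = h s - h t" for s t
    using h unfolding linearQ_iff by (metis add_diff_cancel_right' diff_add_cancel)
  have h_zero: "h 0 = 0"
    using h_diff[of 0 0] by simp
  have "h s = 0" if "s \<in> rat_vector.span tensor_relators" for s
    using that
  proof (induction rule: rat_vector.span_induct_alt)
    case base
    show ?case by (rule h_zero)
  next
    case (step c x y)
    have "h x = 0"
      using step(1) f h unfolding tensor_relators_def
      by (auto simp: h_diff h_basis bilinearQ_def linearQ_iff)
    with step(2) h show ?case
      by (simp add: linearQ_iff)
  qed
  then have h_rel: "h s = h t" if "tensor_rel s t" for s t
    using that h_diff[of s t] by (simp add: tensor_rel_def)
  define g where "g = (\<lambda>t. h (rep_tensor t))"
  have g_abs: "g (abs_tensor s) = h s" for s
    unfolding g_def using h_rel by (metis Quotient_rep_abs Quotient_tensor equivp_tensor_rel equivp_reflp)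
  have abs_ex: "\<exists>s. t = abs_tensor s" for t :: "'a \<otimes> 'b"
    by (metis Quotient_tensor Quotient_abs_rep)
  have "g (s + t) = g s + g t" for s t
    using h abs_ex[of s] abs_ex[of t] by (auto simp: plus_tensor.abs_eq g_abs linearQ_iff)
  moreover have "g (c *\<^sub>Q t) = c *\<^sub>Q g t" for c t
    using h abs_ex[of t] by (auto simp: scaleQ_tensor.abs_eq g_abs linearQ_iff)
  ultimately have "linearQ g"
    by (simp add: linearQ_iff)
  moreover have "g (a \<otimes> b) = f a b" for a b
    by (simp add: tensor.abs_eq g_abs h_basis)
  moreover have "g' = g" if "linearQ g' \<and> (\<forall>a b. g' (a \<otimes> b) = f a b)" for g'
    by (rule ext, rule linearQ_eq_on_tensors) (simp_all add: that \<open>linearQ g\<close> \<open>\<And>a b. g (a \<otimes> b) = f a b\<close>)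
  ultimately show ?thesis
    by blast
qed

lemma
  assumes "bilinearQ f"
  shows linearQ_tensor_lift: "linearQ (tensor_lift f)"
    and tensor_lift_tensor: "tensor_lift f (a \<otimes> b) = f a b"
  using theI'[OF tensor_lift_ex1[OF assms]] by (auto simp: tensor_lift_def)

definition tensor_map ::
    "('a::rat_vector \<Rightarrow> 'c::rat_vector) \<Rightarrow> ('b::rat_vector \<Rightarrow> 'd::rat_vector) \<Rightarrow> ('a \<otimes> 'b) \<Rightarrow> ('c \<otimes> 'd)"
  where "tensor_map f g = tensor_lift (\<lambda>a b. f a \<otimes> g b)"

definition tensor_flip :: "('a::rat_vector \<otimes> 'b::rat_vector) \<Rightarrow> ('b \<otimes> 'a)"
  where "tensor_flip = tensor_lift (\<lambda>a b. b \<otimes> a)"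

definition tensor_assoc ::
    "(('a::rat_vector \<otimes> 'b::rat_vector) \<otimes> 'c::rat_vector) \<Rightarrow> ('a \<otimes> ('b \<otimes> 'c))"
  where "tensor_assoc = tensor_lift (\<lambda>u c. tensor_lift (\<lambda>a b. a \<otimes> (b \<otimes> c)) u)"


section \<open>Bidendriform bialgebras\<close>

locale dendriform_products =
  fixes prec :: "'a::rat_vector \<Rightarrow> 'a \<Rightarrow> 'a"  (infixl \<open>\<prec>\<close> 70)
    and succ :: "'a \<Rightarrow> 'a \<Rightarrow> 'a"  (infixl \<open>\<succ>\<close> 70)
begin

abbreviation mul :: "'a \<Rightarrow> 'a \<Rightarrow> 'a"  (infixl \<open>\<cdot>\<close> 70)
  where "a \<cdot> b \<equiv> a \<prec> b + a \<succ> b"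

end

locale dendriform_algebra = dendriform_products +
  assumes bilinear_prec: "bilinearQ (\<prec>)"
    and bilinear_succ: "bilinearQ (\<succ>)"
    and prec_prec: "(a \<prec> b) \<prec> c = a \<prec> (b \<cdot> c)"
    and succ_prec: "(a \<succ> b) \<prec> c = a \<succ> (b \<prec> c)"
    and mul_succ: "(a \<cdot> b) \<succ> c = a \<succ> (b \<succ> c)"

locale dendriform_coproducts =
  fixes cprec :: "'a::rat_vector \<Rightarrow> 'a \<otimes> 'a"  (\<open>\<Delta>\<^sub>\<prec>\<close>)
    and csucc :: "'a \<Rightarrow> 'a \<otimes> 'a"  (\<open>\<Delta>\<^sub>\<succ>\<close>)
begin

abbreviation ctotal :: "'a \<Rightarrow> 'a \<otimes> 'a"  (\<open>\<Delta>\<close>)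
  where "\<Delta> \<equiv> \<lambda>a. \<Delta>\<^sub>\<prec> a + \<Delta>\<^sub>\<succ> a"

end

locale dendriform_coalgebra = dendriform_coproducts +
  assumes linear_cprec: "linearQ \<Delta>\<^sub>\<prec>"
    and linear_csucc: "linearQ \<Delta>\<^sub>\<succ>"
    and cprec_cprec:
      "tensor_assoc (tensor_map \<Delta>\<^sub>\<prec> id (\<Delta>\<^sub>\<prec> a)) = tensor_map id \<Delta> (\<Delta>\<^sub>\<prec> a)"
    and csucc_cprec:
      "tensor_assoc (tensor_map \<Delta>\<^sub>\<succ> id (\<Delta>\<^sub>\<prec> a)) = tensor_map id \<Delta>\<^sub>\<prec> (\<Delta>\<^sub>\<succ> a)"
    and ctotal_csucc:
      "tensor_assoc (tensor_map \<Delta> id (\<Delta>\<^sub>\<succ> a)) = tensor_map id \<Delta>\<^sub>\<succ> (\<Delta>\<^sub>\<succ> a)"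

locale bidendriform_bialgebra =
  dendriform_algebra prec succ + dendriform_coalgebra cprec csucc
  for prec :: "'a::rat_vector \<Rightarrow> 'a \<Rightarrow> 'a"  (infixl \<open>\<prec>\<close> 70)
    and succ :: "'a \<Rightarrow> 'a \<Rightarrow> 'a"  (infixl \<open>\<succ>\<close> 70)
    and cprec :: "'a \<Rightarrow> 'a \<otimes> 'a"  (\<open>\<Delta>\<^sub>\<prec>\<close>)
    and csucc :: "'a \<Rightarrow> 'a \<otimes> 'a"  (\<open>\<Delta>\<^sub>\<succ>\<close>) +
  assumes csucc_succ: "\<Delta>\<^sub>\<succ> (a \<succ> b) =
        tensor_lift (\<lambda>a' a''. tensor_lift (\<lambda>b' b''. (a' \<cdot> b') \<otimes> (a'' \<succ> b'')) (\<Delta>\<^sub>\<succ> b)) (\<Delta> a)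
      + tensor_lift (\<lambda>a' a''. a' \<otimes> (a'' \<succ> b)) (\<Delta> a)
      + tensor_lift (\<lambda>b' b''. b' \<otimes> (a \<succ> b'')) (\<Delta>\<^sub>\<succ> b)
      + tensor_lift (\<lambda>b' b''. (a \<cdot> b') \<otimes> b'') (\<Delta>\<^sub>\<succ> b)
      + a \<otimes> b"
    and csucc_prec: "\<Delta>\<^sub>\<succ> (a \<prec> b) =
        tensor_lift (\<lambda>a' a''. tensor_lift (\<lambda>b' b''. (a' \<cdot> b') \<otimes> (a'' \<prec> b'')) (\<Delta>\<^sub>\<succ> b)) (\<Delta> a)
      + tensor_lift (\<lambda>a' a''. a' \<otimes> (a'' \<prec> b)) (\<Delta> a)
      + tensor_lift (\<lambda>b' b''. b' \<otimes> (a \<prec> b'')) (\<Delta>\<^sub>\<succ> b)"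
    and cprec_succ: "\<Delta>\<^sub>\<prec> (a \<succ> b) =
        tensor_lift (\<lambda>a' a''. tensor_lift (\<lambda>b' b''. (a' \<cdot> b') \<otimes> (a'' \<succ> b'')) (\<Delta>\<^sub>\<prec> b)) (\<Delta> a)
      + tensor_lift (\<lambda>b' b''. (a \<cdot> b') \<otimes> b'') (\<Delta>\<^sub>\<prec> b)
      + tensor_lift (\<lambda>b' b''. b' \<otimes> (a \<succ> b'')) (\<Delta>\<^sub>\<prec> b)"
    and cprec_prec: "\<Delta>\<^sub>\<prec> (a \<prec> b) =
        tensor_lift (\<lambda>a' a''. tensor_lift (\<lambda>b' b''. (a' \<cdot> b') \<otimes> (a'' \<prec> b'')) (\<Delta>\<^sub>\<prec> b)) (\<Delta> a)
      + tensor_lift (\<lambda>a' a''. (a' \<cdot> b) \<otimes> a'') (\<Delta> a)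
      + tensor_lift (\<lambda>b' b''. b' \<otimes> (a \<prec> b'')) (\<Delta>\<^sub>\<prec> b)
      + b \<otimes> a"


section \<open>Graded permutations\<close>

text \<open>
  A biword \<open>(k, \<sigma>, d)\<close> of length \<open>k \<ge> 1\<close>. The map \<open>d\<close> from \<open>{1..k}\<close> to the positive integers is
  extended by \<open>0\<close>, and \<open>\<sigma>\<close> by the identity, so that equal biwords are equal triples.
\<close>

typedef biword =
  "{(k, \<sigma>, d). k \<ge> 1 \<and> \<sigma> permutes {1..k} \<and>
      (\<forall>i\<in>{1..k}. d i \<ge> 1) \<and> (\<forall>i. i \<notin> {1..k} \<longrightarrow> d i = 0)}
    :: (nat \<times> (nat \<Rightarrow> nat) \<times> (nat \<Rightarrow> nat)) set"
  by (rule exI[of _ "(1, id, \<lambda>i. if i = 1 then 1 else 0)"]) (auto simp: permutes_id)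

definition len :: "biword \<Rightarrow> nat"
  where "len w = fst (Rep_biword w)"

definition perm :: "biword \<Rightarrow> nat \<Rightarrow> nat"
  where "perm w = fst (snd (Rep_biword w))"

definition deg :: "biword \<Rightarrow> nat \<Rightarrow> nat"
  where "deg w = snd (snd (Rep_biword w))"

lemma biword_props:
  "len w \<ge> 1" "perm w permutes {1..len w}"
  "i \<in> {1..len w} \<Longrightarrow> deg w i \<ge> 1" "i \<notin> {1..len w} \<Longrightarrow> deg w i = 0"
  using Rep_biword[of w] by (auto simp: len_def perm_def deg_def)

lemma biword_eqI: "len v = len w \<Longrightarrow> perm v = perm w \<Longrightarrow> deg v = deg w \<Longrightarrow> v = w"
  by (metis Rep_biword_inject len_def perm_def deg_def prod.collapse)

lemma
  assumes "k \<ge> 1" "\<sigma> permutes {1..k}" "\<forall>i\<in>{1..k}. d i \<ge> 1" "\<forall>i. i \<notin> {1..k} \<longrightarrow> d i = 0"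
  shows len_Abs_biword: "len (Abs_biword (k, \<sigma>, d)) = k"
    and perm_Abs_biword: "perm (Abs_biword (k, \<sigma>, d)) = \<sigma>"
    and deg_Abs_biword: "deg (Abs_biword (k, \<sigma>, d)) = d"
  using assms by (simp_all add: len_def perm_def deg_def Abs_biword_inverse)

type_synonym Splus = "biword \<Rightarrow>\<^sub>0 rat"


subsection \<open>Products\<close>

definition perm_tensor :: "nat \<Rightarrow> nat \<Rightarrow> (nat \<Rightarrow> nat) \<Rightarrow> (nat \<Rightarrow> nat) \<Rightarrow> nat \<Rightarrow> nat"
  where "perm_tensor k l \<sigma> \<tau> i =
    (if i \<le> k then \<sigma> i else if i \<le> k + l then \<tau> (i - k) + k else i)"

definition deg_tensor :: "nat \<Rightarrow> (nat \<Rightarrow> nat) \<Rightarrow> (nat \<Rightarrow> nat) \<Rightarrow> nat \<Rightarrow> nat"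
  where "deg_tensor k d e i = (if i \<le> k then d i else e (i - k))"

definition shuffle_perms :: "nat \<Rightarrow> nat \<Rightarrow> (nat \<Rightarrow> nat) set"
  where "shuffle_perms k l = {\<alpha>. \<alpha> permutes {1..k + l} \<and>
    strict_mono_on {1..k} \<alpha> \<and> strict_mono_on {k + 1..k + l} \<alpha>}"

definition shuffle_biword :: "biword \<Rightarrow> biword \<Rightarrow> (nat \<Rightarrow> nat) \<Rightarrow> biword"
  where "shuffle_biword v w \<alpha> = Abs_biword
    (len v + len w,
     perm_tensor (len v) (len w) (perm v) (perm w) \<circ> inv \<alpha>,
     deg_tensor (len v) (deg v) (deg w) \<circ> inv \<alpha>)"

lemma perm_tensor_permutes:
  assumes "\<sigma> permutes {1..k}" "\<tau> permutes {1..l}"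
  shows "perm_tensor k l \<sigma> \<tau> permutes {1..k + l}"
proof (rule bij_imp_permutes)
  have \<sigma>: "\<sigma> i \<in> {1..k} \<longleftrightarrow> i \<in> {1..k}" and \<tau>: "\<tau> i \<in> {1..l} \<longleftrightarrow> i \<in> {1..l}" for i
    using assms by (simp_all only: permutes_in_image)
  have "inj_on (perm_tensor k l \<sigma> \<tau>) {1..k + l}"
  proof (rule inj_onI)
    fix i j assume ij: "i \<in> {1..k + l}" "j \<in> {1..k + l}"
      and eq: "perm_tensor k l \<sigma> \<tau> i = perm_tensor k l \<sigma> \<tau> j"
    have inj: "\<sigma> a = \<sigma> b \<longleftrightarrow> a = b" "\<tau> a = \<tau> b \<longleftrightarrow> a = b" for a b
      using assms by (meson permutes_inj inj_eq)+
    show "i = j"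
      using ij eq \<sigma>[of i] \<sigma>[of j] \<tau>[of "i - k"] \<tau>[of "j - k"]
      by (auto simp: perm_tensor_def inj split: if_splits)
  qed
  moreover have "perm_tensor k l \<sigma> \<tau> ` {1..k + l} \<subseteq> {1..k + l}"
  proof
    fix x assume "x \<in> perm_tensor k l \<sigma> \<tau> ` {1..k + l}"
    then obtain i where i: "i \<in> {1..k + l}" "x = perm_tensor k l \<sigma> \<tau> i" by blast
    show "x \<in> {1..k + l}"
      using i \<sigma>[of i] \<tau>[of "i - k"] by (auto simp: perm_tensor_def split: if_splits)
  qed
  ultimately show "bij_betw (perm_tensor k l \<sigma> \<tau>) {1..k + l} {1..k + l}"
    by (simp add: bij_betw_def endo_inj_surj)
  show "perm_tensor k l \<sigma> \<tau> x = x" if "x \<notin> {1..k + l}" for x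
    using that assms by (auto simp: perm_tensor_def permutes_def)
qed

lemma
  assumes "\<alpha> permutes {1..len v + len w}"
  shows len_shuffle_biword: "len (shuffle_biword v w \<alpha>) = len v + len w"
    and perm_shuffle_biword: "perm (shuffle_biword v w \<alpha>) =
      perm_tensor (len v) (len w) (perm v) (perm w) \<circ> inv \<alpha>"
    and deg_shuffle_biword: "deg (shuffle_biword v w \<alpha>) =
      deg_tensor (len v) (deg v) (deg w) \<circ> inv \<alpha>"
proof -
  have inv: "inv \<alpha> permutes {1..len v + len w}"
    by (rule permutes_inv[OF assms])
  have 1: "len v + len w \<ge> 1"
    using biword_props(1)[of v] by simp
  have 2: "perm_tensor (len v) (len w) (perm v) (perm w) \<circ> inv \<alpha> permutes {1..len v + len w}"
    by (rule permutes_compose[OF inv perm_tensor_permutes[OF biword_props(2) biword_props(2)]])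
  have *: "deg_tensor (len v) (deg v) (deg w) i \<ge> 1" if "i \<in> {1..len v + len w}" for i
    using that biword_props(3)[of i v] biword_props(3)[of "i - len v" w]
    by (cases "i \<le> len v") (simp_all add: deg_tensor_def le_diff_conv)
  have 3: "\<forall>i\<in>{1..len v + len w}. (deg_tensor (len v) (deg v) (deg w) \<circ> inv \<alpha>) i \<ge> 1"
    using * permutes_in_image[OF inv] by (metis comp_apply)
  have **: "deg_tensor (len v) (deg v) (deg w) i = 0" if "i \<notin> {1..len v + len w}" for i
    using that biword_props(4)[of i v] biword_props(4)[of "i - len v" w]
    by (auto simp: deg_tensor_def le_diff_conv add.commute)
  have 4: "\<forall>i. i \<notin> {1..len v + len w} \<longrightarrow> (deg_tensor (len v) (deg v) (deg w) \<circ> inv \<alpha>) i = 0"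
    using ** permutes_in_image[OF inv] by (metis comp_apply)
  show "len (shuffle_biword v w \<alpha>) = len v + len w"
    "perm (shuffle_biword v w \<alpha>) = perm_tensor (len v) (len w) (perm v) (perm w) \<circ> inv \<alpha>"
    "deg (shuffle_biword v w \<alpha>) = deg_tensor (len v) (deg v) (deg w) \<circ> inv \<alpha>"
    unfolding shuffle_biword_def
    using len_Abs_biword[OF 1 2 3 4] perm_Abs_biword[OF 1 2 3 4] deg_Abs_biword[OF 1 2 3 4] .
qed

definition S_prec :: "Splus \<Rightarrow> Splus \<Rightarrow> Splus"  (infixl \<open>\<prec>\<close> 70)
  where "x \<prec> y = lin_ext (\<lambda>v. lin_ext (\<lambda>w.
    \<Sum>\<alpha>\<in>{\<alpha> \<in> shuffle_perms (len v) (len w). inv \<alpha> 1 = 1}. basis_vec (shuffle_biword v w \<alpha>)) y) x"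

definition S_succ :: "Splus \<Rightarrow> Splus \<Rightarrow> Splus"  (infixl \<open>\<succ>\<close> 70)
  where "x \<succ> y = lin_ext (\<lambda>v. lin_ext (\<lambda>w.
    \<Sum>\<alpha>\<in>{\<alpha> \<in> shuffle_perms (len v) (len w). inv \<alpha> 1 = len v + 1}.
      basis_vec (shuffle_biword v w \<alpha>)) y) x"

definition S_star :: "Splus \<Rightarrow> Splus \<Rightarrow> Splus"  (infixl \<open>\<star>\<close> 70)
  where "x \<star> y = x \<prec> y + x \<succ> y"

lemma finite_shuffle_perms: "finite (shuffle_perms k l)"
  by (rule finite_subset[OF _ finite_permutations[of "{1..k + l}"]]) (auto simp: shuffle_perms_def)


subsection \<open>Coproducts\<close>

text \<open>\<open>rank A\<close> is the increasing bijection from \<open>A\<close> to \<open>{1..card A}\<close>.\<close>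

definition rank :: "nat set \<Rightarrow> nat \<Rightarrow> nat"
  where "rank A a = card {b \<in> A. b \<le> a}"

lemma
  assumes "finite A"
  shows strict_mono_on_rank: "strict_mono_on A (rank A)"
    and bij_betw_rank: "bij_betw (rank A) A {1..card A}"
proof -
  show mono: "strict_mono_on A (rank A)"
    unfolding rank_def
    by (rule strict_mono_onI, rule psubset_card_mono) (use assms in \<open>force+\<close>)
  have "rank A a \<in> {1..card A}" if "a \<in> A" for a
  proof -
    have "0 < card {b \<in> A. b \<le> a}"
      using assms that by (subst card_gt_0_iff) auto
    moreover have "card {b \<in> A. b \<le> a} \<le> card A"
      using assms by (intro card_mono) auto
    ultimately show ?thesis by (simp add: rank_def)
  qed
  then have "rank A ` A \<subseteq> {1..card A}" by blast
  moreover have inj: "inj_on (rank A) A"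
    using mono by (rule strict_mono_on_imp_inj_on)
  ultimately have "rank A ` A = {1..card A}"
    by (intro card_subset_eq) (simp_all add: card_image)
  with inj show "bij_betw (rank A) A {1..card A}"
    by (simp add: bij_betw_def)
qed

text \<open>Standardization of the word \<open>u 1, \<dots>, u m\<close>, extended by the identity.\<close>

definition std :: "nat \<Rightarrow> (nat \<Rightarrow> nat) \<Rightarrow> nat \<Rightarrow> nat"
  where "std m u i = (if i \<in> {1..m} then rank (u ` {1..m}) (u i) else i)"

lemma std_permutes:
  assumes "inj_on u {1..m}"
  shows "std m u permutes {1..m}"
proof (rule bij_imp_permutes)
  have "bij_betw (rank (u ` {1..m}) \<circ> u) {1..m} {1..m}"
    using bij_betw_trans[OF inj_on_imp_bij_betw[OF assms] bij_betw_rank[of "u ` {1..m}"]] assms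
    by (simp add: card_image)
  then show "bij_betw (std m u) {1..m} {1..m}"
    by (subst bij_betw_cong[of _ _ "rank (u ` {1..m}) \<circ> u"]) (simp_all add: std_def)
qed (auto simp: std_def)

text \<open>The standardized factor of \<open>w\<close> on the positions \<open>p + 1, \<dots>, p + m\<close>.\<close>

definition factor :: "biword \<Rightarrow> nat \<Rightarrow> nat \<Rightarrow> biword"
  where "factor w p m = Abs_biword
    (m, std m (\<lambda>i. perm w (p + i)), \<lambda>i. if i \<in> {1..m} then deg w (p + i) else 0)"

lemma
  assumes "m \<ge> 1" "p + m \<le> len w"
  shows len_factor: "len (factor w p m) = m"
    and perm_factor: "perm (factor w p m) = std m (\<lambda>i. perm w (p + i))"
    and deg_factor: "deg (factor w p m) = (\<lambda>i. if i \<in> {1..m} then deg w (p + i) else 0)"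
proof -
  have "inj_on (\<lambda>i. perm w (p + i)) {1..m}"
    using permutes_inj[OF biword_props(2)[of w]] by (auto intro!: inj_onI dest!: injD)
  note 2 = std_permutes[OF this]
  have 3: "\<forall>i\<in>{1..m}. (if i \<in> {1..m} then deg w (p + i) else 0) \<ge> 1"
    using assms biword_props(3)[of _ w] by auto
  have 4: "\<forall>i. i \<notin> {1..m} \<longrightarrow> (if i \<in> {1..m} then deg w (p + i) else 0) = 0"
    by auto
  show "len (factor w p m) = m"
    "perm (factor w p m) = std m (\<lambda>i. perm w (p + i))"
    "deg (factor w p m) = (\<lambda>i. if i \<in> {1..m} then deg w (p + i) else 0)"
    unfolding factor_def
    using len_Abs_biword[OF assms(1) 2 3 4] perm_Abs_biword[OF assms(1) 2 3 4]
      deg_Abs_biword[OF assms(1) 2 3 4] .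
qed

definition S_cprec :: "Splus \<Rightarrow> Splus \<otimes> Splus"  (\<open>\<Delta>\<^sub>\<prec>\<close>)
  where "\<Delta>\<^sub>\<prec> = lin_ext (\<lambda>w. \<Sum>i\<in>{inv (perm w) 1..len w - 1}.
    basis_vec (factor w 0 i) \<otimes> basis_vec (factor w i (len w - i)))"

definition S_csucc :: "Splus \<Rightarrow> Splus \<otimes> Splus"  (\<open>\<Delta>\<^sub>\<succ>\<close>)
  where "\<Delta>\<^sub>\<succ> = lin_ext (\<lambda>w. \<Sum>i\<in>{1..inv (perm w) 1 - 1}.
    basis_vec (factor w 0 i) \<otimes> basis_vec (factor w i (len w - i)))"

definition S_ctotal :: "Splus \<Rightarrow> Splus \<otimes> Splus"  (\<open>\<Delta>\<close>)
  where "\<Delta> x = \<Delta>\<^sub>\<prec> x + \<Delta>\<^sub>\<succ> x"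

end

theory Submission
  imports Defs
begin

text \<open>
  A biword is the standardization of a word of letters with degrees, so it remembers only the
  relative order of the letters. Basis vectors are therefore written \<open>\<langle>z\<rangle>\<close> for an arbitrary word \<open>z\<close>
  with distinct letters, and a product of two of them may be computed on representatives \<open>u\<close> and
  \<open>v\<close> in which all letters of \<open>u\<close> are smaller than all letters of \<open>v\<close>. No letter has to be
  renamed then: \<open>\<langle>u\<rangle> \<prec> \<langle>v\<rangle>\<close> and \<open>\<langle>u\<rangle> \<succ> \<langle>v\<rangle>\<close> are the sums of the shuffles of \<open>u\<close> and \<open>v\<close> that
  begin with the first letter of \<open>u\<close>, respectively of \<open>v\<close> (\<open>S_prec_word\<close>, \<open>S_succ_word\<close>). The
  coproducts cut \<open>z\<close> in two, and a cut counts for \<open>\<Delta>\<^sub>\<prec>\<close> or for \<open>\<Delta>\<^sub>\<succ>\<close> according to whether the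
  smallest letter of \<open>z\<close> falls into the left or into the right factor (\<open>S_coprod_word\<close>).

  The four formulas rest on one fact: to cut a shuffle of \<open>u\<close> and \<open>v\<close> is to cut \<open>u\<close> and \<open>v\<close>, to
  shuffle the two left factors, and to shuffle the two right factors (\<open>deconc_sum_shuffle\<close>). The
  first letter of the shuffle stays in the left factor, so the left factors are multiplied by the
  same half product and the right ones by \<open>\<star>\<close>. The smallest letter of the shuffle is the smallest
  letter of \<open>u\<close>, so the cut of \<open>u\<close> alone decides which of the two coproducts a cut counts
  for. The terms of the formulas correspond to the possibilities for the cuts of \<open>u\<close> and \<open>v\<close> to
  be proper or to have an empty side (\<open>S_coprod_prec_word\<close>, \<open>S_coprod_succ_word\<close>).

  For the bidendriform bialgebra, the dendriform axioms express the associativity of shuffling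
  (\<open>shuffle_sum_assoc\<close>), one axiom for each of the three words that can supply the first letter.
  In the same way there is one coalgebra axiom for each of the three parts of a doubly cut word
  that can contain the smallest letter. The four compatibilities are the formulas above, flipped
  and with the two arguments exchanged.
\<close>


section \<open>Bilinear maps and tensor products\<close>

lemma bilinearQ_iff:
  "bilinearQ f \<longleftrightarrow>
    (\<forall>x y z. f x (y + z) = f x y + f x z) \<and> (\<forall>x y z. f (x + y) z = f x z + f y z) \<and>
    (\<forall>c x y. f x (c *\<^sub>Q y) = c *\<^sub>Q f x y) \<and> (\<forall>c x y. f (c *\<^sub>Q x) y = c *\<^sub>Q f x y)"
  unfolding bilinearQ_def linearQ_iff by metis

lemma
  assumes "bilinearQ f"
  shows bilinearQ_add_left: "f (x + x') y = f x y + f x' y"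
    and bilinearQ_add_right: "f x (y + y') = f x y + f x y'"
    and bilinearQ_scale_left: "f (c *\<^sub>Q x) y = c *\<^sub>Q f x y"
    and bilinearQ_scale_right: "f x (c *\<^sub>Q y) = c *\<^sub>Q f x y"
  using assms unfolding bilinearQ_iff by blast+

lemma
  fixes a :: "'a::rat_vector" and b :: "'b::rat_vector"
  shows tensor_add_right: "a \<otimes> (b + b') = a \<otimes> b + a \<otimes> b'"
    and tensor_add_left: "(a + a') \<otimes> b = a \<otimes> b + a' \<otimes> b"
    and tensor_scale_right: "a \<otimes> (c *\<^sub>Q b) = c *\<^sub>Q (a \<otimes> b)"
    and tensor_scale_left: "(c *\<^sub>Q a) \<otimes> b = c *\<^sub>Q (a \<otimes> b)"
  using bilinearQ_tensor unfolding bilinearQ_iff by blast+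

lemmas tensor_bilinear = tensor_add_right tensor_add_left tensor_scale_right tensor_scale_left

lemma linearQ_zero: "linearQ f \<Longrightarrow> f 0 = 0"
  unfolding linearQ_iff by (metis add_cancel_right_right)

lemma linearQ_comp: "linearQ f \<Longrightarrow> linearQ g \<Longrightarrow> linearQ (\<lambda>x. f (g x))"
  by (simp add: linearQ_iff)

lemma
  assumes "bilinearQ f"
  shows bilinearQ_zero_left: "f 0 y = 0" and bilinearQ_zero_right: "f x 0 = 0"
  using assms linearQ_zero[of "f x"] linearQ_zero[of "\<lambda>x. f x y"] by (auto simp: bilinearQ_def)

lemmas tensor_zero = bilinearQ_zero_left[OF bilinearQ_tensor] bilinearQ_zero_right[OF bilinearQ_tensor]

lemma bilinearQ_eq_on_basis:
  assumes "bilinearQ f" "bilinearQ g" "\<And>b c. f (basis_vec b) (basis_vec c) = g (basis_vec b) (basis_vec c)"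
  shows "f x y = g x y"
proof (rule linearQ_eq_on_basis[of "f x" "g x"])
  show "linearQ (f x)" "linearQ (g x)"
    using assms(1,2) by (simp_all add: bilinearQ_def)
  show "f x (basis_vec c) = g x (basis_vec c)" for c
    by (rule linearQ_eq_on_basis[of "\<lambda>x. f x (basis_vec c)" "\<lambda>x. g x (basis_vec c)"])
      (use assms in \<open>simp_all add: bilinearQ_def\<close>)
qed

text \<open>
  This turns identities between linear maps on a tensor product into identities of finite sums
  of pure tensors, in which \<open>tensor_lift\<close> can be evaluated term by term.
\<close>
lemma tensor_is_sum:
  fixes t :: "'a::rat_vector \<otimes> 'b::rat_vector"
  shows "\<exists>n a b. t = (\<Sum>i<(n::nat). a i \<otimes> b i)"
proof -
  obtain s where s: "t = abs_tensor s"
    by (metis Quotient_tensor Quotient_abs_rep)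
  have lin: "linearQ (abs_tensor :: _ \<Rightarrow> 'a \<otimes> 'b)"
    by (simp add: linearQ_iff plus_tensor.abs_eq scaleQ_tensor.abs_eq)
  have basis: "abs_tensor (basis_vec k) = fst k \<otimes> snd k" for k :: "'a \<times> 'b"
    by (simp add: tensor.abs_eq)
  obtain n and p where p: "Poly_Mapping.keys s = p ` {..<n::nat}" "inj_on p {..<n}"
    using finite_imp_nat_seg_image_inj_on[of "Poly_Mapping.keys s"]
    by (auto simp: lessThan_def)
  have "t = (\<Sum>k\<in>Poly_Mapping.keys s. Poly_Mapping.lookup s k *\<^sub>Q abs_tensor (basis_vec k))"
    unfolding s using lin by (subst basis_vec_expansion, subst linearQ_sum) (simp_all add: linearQ_iff)
  also have "\<dots> = (\<Sum>i<n. (Poly_Mapping.lookup s (p i) *\<^sub>Q fst (p i)) \<otimes> snd (p i))"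
    using p basis by (simp add: sum.reindex tensor_scale_left)
  finally show ?thesis
    by (intro exI[of _ n] exI[of _ "\<lambda>i. Poly_Mapping.lookup s (p i) *\<^sub>Q fst (p i)"] exI[of _ "\<lambda>i. snd (p i)"])
qed

lemma tensor_lift_sum:
  assumes "bilinearQ f"
  shows "tensor_lift f (\<Sum>i\<in>I. a i \<otimes> b i) = (\<Sum>i\<in>I. f (a i) (b i))"
  using assms by (simp add: linearQ_sum[OF linearQ_tensor_lift] tensor_lift_tensor)

lemma
  assumes "bilinearQ f"
  shows tensor_lift_add: "tensor_lift f (s + t) = tensor_lift f s + tensor_lift f t"
    and tensor_lift_scale: "tensor_lift f (c *\<^sub>Q t) = c *\<^sub>Q tensor_lift f t"
    and tensor_lift_zero: "tensor_lift f 0 = 0"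
  using linearQ_tensor_lift[OF assms] linearQ_zero by (auto simp: linearQ_iff)

text \<open>
  Linearity of \<open>tensor_lift\<close> in the bilinear map is what makes a nested \<open>tensor_lift\<close> bilinear in
  the parameters of its inner map.
\<close>
lemma tensor_lift_fun_add:
  assumes "bilinearQ f" "bilinearQ g"
  shows "tensor_lift (\<lambda>a b. f a b + g a b) t = tensor_lift f t + tensor_lift g t"
proof -
  have "bilinearQ (\<lambda>a b. f a b + g a b)"
    using assms by (simp add: bilinearQ_iff scaleQ_add_right algebra_simps)
  then show ?thesis
    using assms tensor_is_sum[of t] by (auto simp: tensor_lift_sum sum.distrib)
qed

lemma tensor_lift_fun_scale:
  assumes "bilinearQ f"
  shows "tensor_lift (\<lambda>a b. c *\<^sub>Q f a b) t = c *\<^sub>Q tensor_lift f t"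
proof -
  have "bilinearQ (\<lambda>a b. c *\<^sub>Q f a b)"
    using assms by (simp add: bilinearQ_iff scaleQ_add_right scaleQ_scaleQ mult.commute)
  then show ?thesis
    using assms tensor_is_sum[of t] by (auto simp: tensor_lift_sum rat_vector.scale_sum_right)
qed

text \<open>
  The special case of a pure tensor whose right factor is the second argument itself: there the
  inner abstraction is eta-contracted, and rewriting with the general rules does not find it.
\<close>
lemma
  assumes "linearQ f"
  shows tensor_lift_left_add: "linearQ g \<Longrightarrow> tensor_lift (\<lambda>a. (\<otimes>) (f a + g a)) t =
      tensor_lift (\<lambda>a. (\<otimes>) (f a)) t + tensor_lift (\<lambda>a. (\<otimes>) (g a)) t"
    and tensor_lift_left_scale: "tensor_lift (\<lambda>a. (\<otimes>) (c *\<^sub>Q f a)) t =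
      c *\<^sub>Q tensor_lift (\<lambda>a. (\<otimes>) (f a)) t"
proof -
  have bilin: "bilinearQ (\<lambda>a b. h a \<otimes> b)" if "linearQ h" for h :: "'a \<Rightarrow> 'b"
    using that by (simp add: bilinearQ_iff linearQ_iff tensor_bilinear)
  show "tensor_lift (\<lambda>a. (\<otimes>) (f a + g a)) t =
      tensor_lift (\<lambda>a. (\<otimes>) (f a)) t + tensor_lift (\<lambda>a. (\<otimes>) (g a)) t" if "linearQ g"
    using tensor_lift_fun_add[OF bilin[OF assms] bilin[OF that], of t] by (simp flip: tensor_add_left)
  show "tensor_lift (\<lambda>a. (\<otimes>) (c *\<^sub>Q f a)) t = c *\<^sub>Q tensor_lift (\<lambda>a. (\<otimes>) (f a)) t"
    using tensor_lift_fun_scale[OF bilin[OF assms], of c t] by (simp flip: tensor_scale_left)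
qed

lemma bilinearQ_flip: "bilinearQ (\<lambda>a b. b \<otimes> a)"
  by (simp add: bilinearQ_iff tensor_bilinear)

lemma linearQ_flip: "linearQ tensor_flip"
  unfolding tensor_flip_def by (rule linearQ_tensor_lift[OF bilinearQ_flip])

lemma tensor_flip_sum: "tensor_flip (\<Sum>i\<in>I. a i \<otimes> b i) = (\<Sum>i\<in>I. b i \<otimes> a i)"
  unfolding tensor_flip_def by (rule tensor_lift_sum[OF bilinearQ_flip])

lemma tensor_flip_tensor: "tensor_flip (a \<otimes> b) = b \<otimes> a"
  unfolding tensor_flip_def by (rule tensor_lift_tensor[OF bilinearQ_flip])

lemma
  fixes s t :: "'a::rat_vector \<otimes> 'b::rat_vector"
  shows tensor_flip_add: "tensor_flip (s + t) = tensor_flip s + tensor_flip t"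
    and tensor_flip_scale: "tensor_flip (c *\<^sub>Q t) = c *\<^sub>Q tensor_flip t"
proof -
  have "linearQ (tensor_flip :: 'a \<otimes> 'b \<Rightarrow> _)"
    by (rule linearQ_flip)
  then show "tensor_flip (s + t) = tensor_flip s + tensor_flip t"
    and "tensor_flip (c *\<^sub>Q t) = c *\<^sub>Q tensor_flip t"
    by (simp_all add: linearQ_iff)
qed

lemma bilinearQ_map: "linearQ f \<Longrightarrow> linearQ g \<Longrightarrow> bilinearQ (\<lambda>a b. f a \<otimes> g b)"
  by (simp add: bilinearQ_iff linearQ_iff tensor_bilinear)

lemma
  assumes "bilinearQ f" "bilinearQ g"
  shows bilinearQ_tensor_slots:
    "bilinearQ (\<lambda>a b. f x a \<otimes> g y b)" "bilinearQ (\<lambda>a b. f a x \<otimes> g b y)"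
    "bilinearQ (\<lambda>a b. f x a \<otimes> b)" "bilinearQ (\<lambda>a b. f a x \<otimes> b)"
    "bilinearQ (\<lambda>a b. a \<otimes> g y b)" "bilinearQ (\<lambda>a b. a \<otimes> g b y)"
proof -
  have lin: "linearQ (f x)" "linearQ (\<lambda>a. f a x)" "linearQ (g y)" "linearQ (\<lambda>b. g b y)"
    using assms by (simp_all add: bilinearQ_def)
  have id: "linearQ (\<lambda>a. a)"
    by (simp add: linearQ_iff)
  show "bilinearQ (\<lambda>a b. f x a \<otimes> g y b)" "bilinearQ (\<lambda>a b. f a x \<otimes> g b y)"
    "bilinearQ (\<lambda>a b. f x a \<otimes> b)" "bilinearQ (\<lambda>a b. f a x \<otimes> b)"
    "bilinearQ (\<lambda>a b. a \<otimes> g y b)" "bilinearQ (\<lambda>a b. a \<otimes> g b y)"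
    by (rule bilinearQ_map lin id)+
qed

lemma linearQ_map: "linearQ f \<Longrightarrow> linearQ g \<Longrightarrow> linearQ (tensor_map f g)"
  unfolding tensor_map_def by (rule linearQ_tensor_lift[OF bilinearQ_map])

lemma tensor_map_tensor:
  "linearQ f \<Longrightarrow> linearQ g \<Longrightarrow> tensor_map f g (a \<otimes> b) = f a \<otimes> g b"
  unfolding tensor_map_def by (simp add: tensor_lift_tensor bilinearQ_map)

lemma bilinearQ_assoc_inner: "bilinearQ (\<lambda>a b. a \<otimes> (b \<otimes> c))"
  by (simp add: bilinearQ_iff tensor_bilinear)

lemma bilinearQ_assoc: "bilinearQ (\<lambda>u c. tensor_lift (\<lambda>a b. a \<otimes> (b \<otimes> c)) u)"
  unfolding bilinearQ_iff
  by (simp add: tensor_lift_add tensor_lift_scale bilinearQ_assoc_inner tensor_bilinear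
      tensor_lift_fun_add tensor_lift_fun_scale)

lemma linearQ_assoc: "linearQ tensor_assoc"
  unfolding tensor_assoc_def by (rule linearQ_tensor_lift[OF bilinearQ_assoc])

lemma tensor_assoc_tensor: "tensor_assoc ((a \<otimes> b) \<otimes> c) = a \<otimes> (b \<otimes> c)"
  unfolding tensor_assoc_def by (simp add: tensor_lift_tensor bilinearQ_assoc bilinearQ_assoc_inner)

lemma flip_tensor_lift:
  assumes "bilinearQ f"
  shows "tensor_flip (tensor_lift f t) = tensor_lift (\<lambda>a b. tensor_flip (f b a)) (tensor_flip t)"
proof -
  obtain n and a b where t: "t = (\<Sum>i<(n::nat). a i \<otimes> b i)"
    using tensor_is_sum by blast
  have "bilinearQ (\<lambda>a b. tensor_flip (f b a))"
    using assms by (simp add: bilinearQ_iff tensor_flip_add tensor_flip_scale)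
  then show ?thesis
    by (simp add: t assms tensor_lift_sum tensor_flip_sum linearQ_sum[OF linearQ_flip])
qed

text \<open>
  The flip of a product of two coproducts: the left and right factors trade places in both, and
  the order of the two summations is exchanged. This is how the formulas pass to the opposite
  structure.
\<close>
lemma flip_tensor_lift_product:
  assumes f: "bilinearQ f" and g: "bilinearQ g"
  shows "tensor_flip (tensor_lift (\<lambda>x' x''. tensor_lift (\<lambda>y' y''. f x' y' \<otimes> g x'' y'') t) s) =
    tensor_lift (\<lambda>y' y''. tensor_lift (\<lambda>x' x''. g x' y' \<otimes> f x'' y'') (tensor_flip s)) (tensor_flip t)"
proof -
  obtain n and a b where t: "t = (\<Sum>i<(n::nat). a i \<otimes> b i)"
    using tensor_is_sum by blast
  obtain m and c d where s: "s = (\<Sum>i<(m::nat). c i \<otimes> d i)"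
    using tensor_is_sum by blast
  note bilin = bilinearQ_add_left bilinearQ_add_right bilinearQ_scale_left bilinearQ_scale_right
  have [simp]: "bilinearQ (\<lambda>y' y''. f x' y' \<otimes> g x'' y'')" "bilinearQ (\<lambda>x' x''. g x' y' \<otimes> f x'' y'')"
    for x' x'' y' y''
    using bilin[OF f] bilin[OF g] by (simp_all add: bilinearQ_iff tensor_bilinear)
  have [simp]: "bilinearQ (\<lambda>x' x''. \<Sum>i<n. f x' (a i) \<otimes> g x'' (b i))"
    "bilinearQ (\<lambda>y' y''. \<Sum>i<m. g (d i) y' \<otimes> f (c i) y'')"
    using bilin[OF f] bilin[OF g]
    by (simp_all add: bilinearQ_iff tensor_bilinear sum.distrib rat_vector.scale_sum_right)
  show ?thesis
    by (simp add: s t tensor_lift_sum tensor_flip_sum linearQ_sum[OF linearQ_flip] tensor_flip_tensor)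
      (rule sum.swap)
qed


section \<open>Shuffles of lists\<close>

text \<open>
  The sum of \<open>F\<close> over the shuffles of two lists, with multiplicity. The summand is a function, so
  that shuffles of shuffles are composed sums and identities between them go by induction.
\<close>
fun shuffle_sum :: "('a list \<Rightarrow> 'v::comm_monoid_add) \<Rightarrow> 'a list \<Rightarrow> 'a list \<Rightarrow> 'v" where
  "shuffle_sum F [] v = F v"
| "shuffle_sum F (x # u) [] = F (x # u)"
| "shuffle_sum F (x # u) (y # v) =
    shuffle_sum (\<lambda>z. F (x # z)) u (y # v) + shuffle_sum (\<lambda>z. F (y # z)) (x # u) v"

text \<open>
  The half shuffles behind \<open>\<prec>\<close> and \<open>\<succ>\<close>: a prescribed list supplies the first letter.
\<close>
fun left_sum :: "('a list \<Rightarrow> 'v::comm_monoid_add) \<Rightarrow> 'a list \<Rightarrow> 'a list \<Rightarrow> 'v" where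
  "left_sum F [] v = 0"
| "left_sum F (x # u) v = shuffle_sum (\<lambda>z. F (x # z)) u v"

fun right_sum :: "('a list \<Rightarrow> 'v::comm_monoid_add) \<Rightarrow> 'a list \<Rightarrow> 'a list \<Rightarrow> 'v" where
  "right_sum F u [] = 0"
| "right_sum F u (y # v) = shuffle_sum (\<lambda>z. F (y # z)) u v"

lemma shuffle_sum_Nil_left [simp]: "shuffle_sum F [] = F"
  by (simp add: fun_eq_iff)

lemma shuffle_sum_Nil_right [simp]: "shuffle_sum F u [] = F u"
  by (cases u) simp_all

lemma left_sum_Nil_right: "u \<noteq> [] \<Longrightarrow> left_sum F u [] = F u"
  by (cases u) simp_all

lemma right_sum_Nil_left: "v \<noteq> [] \<Longrightarrow> right_sum F [] v = F v"
  by (cases v) simp_all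

lemma shuffle_sum_split:
  "u \<noteq> [] \<or> v \<noteq> [] \<Longrightarrow> shuffle_sum F u v = left_sum F u v + right_sum F u v"
  by (cases u; cases v) simp_all

lemma shuffle_sum_zero [simp]: "shuffle_sum (\<lambda>z. 0) u v = 0"
  by (induction u v rule: shuffles.induct) simp_all

lemma left_sum_zero [simp]: "left_sum (\<lambda>z. 0) u v = 0"
  by (cases u) simp_all

lemma right_sum_zero [simp]: "right_sum (\<lambda>z. 0) u v = 0"
  by (cases v) simp_all

lemma shuffle_sum_add:
  "shuffle_sum (\<lambda>z. F z + G z) u v = shuffle_sum F u v + shuffle_sum G u v"
  by (induction u v arbitrary: F G rule: shuffles.induct) (simp_all add: ac_simps)

lemma shuffle_sum_linear: "linearQ h \<Longrightarrow> h (shuffle_sum F u v) = shuffle_sum (\<lambda>z. h (F z)) u v"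
  by (induction F u v rule: shuffle_sum.induct) (simp_all add: linearQ_iff)

lemma left_sum_linear: "linearQ h \<Longrightarrow> h (left_sum F u v) = left_sum (\<lambda>z. h (F z)) u v"
  by (cases u) (simp_all add: shuffle_sum_linear linearQ_zero)

lemma right_sum_linear: "linearQ h \<Longrightarrow> h (right_sum F u v) = right_sum (\<lambda>z. h (F z)) u v"
  by (cases v) (simp_all add: shuffle_sum_linear linearQ_zero)

lemma
  fixes f g :: "'a list \<Rightarrow> 'v::rat_vector"
  shows left_sum_tensor: "left_sum (\<lambda>p. shuffle_sum (\<lambda>q. f p \<otimes> g q) u\<^sub>2 v\<^sub>2) u\<^sub>1 v\<^sub>1 =
      left_sum f u\<^sub>1 v\<^sub>1 \<otimes> shuffle_sum g u\<^sub>2 v\<^sub>2"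
    and right_sum_tensor: "right_sum (\<lambda>p. shuffle_sum (\<lambda>q. f p \<otimes> g q) u\<^sub>2 v\<^sub>2) u\<^sub>1 v\<^sub>1 =
      right_sum f u\<^sub>1 v\<^sub>1 \<otimes> shuffle_sum g u\<^sub>2 v\<^sub>2"
proof -
  have 1: "linearQ (\<lambda>b. a \<otimes> b)" and 2: "linearQ (\<lambda>a. a \<otimes> b)" for a b :: 'v
    using bilinearQ_tensor by (auto simp: bilinearQ_def)
  show "left_sum (\<lambda>p. shuffle_sum (\<lambda>q. f p \<otimes> g q) u\<^sub>2 v\<^sub>2) u\<^sub>1 v\<^sub>1 =
      left_sum f u\<^sub>1 v\<^sub>1 \<otimes> shuffle_sum g u\<^sub>2 v\<^sub>2"
    and "right_sum (\<lambda>p. shuffle_sum (\<lambda>q. f p \<otimes> g q) u\<^sub>2 v\<^sub>2) u\<^sub>1 v\<^sub>1 =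
      right_sum f u\<^sub>1 v\<^sub>1 \<otimes> shuffle_sum g u\<^sub>2 v\<^sub>2"
    by (simp_all add: shuffle_sum_linear[OF 1, symmetric] left_sum_linear[OF 2] right_sum_linear[OF 2])
qed

lemma shuffle_sum_map:
  "shuffle_sum F (map f u) (map f v) = shuffle_sum (\<lambda>z. F (map f z)) u v"
  by (induction u v arbitrary: F rule: shuffles.induct) simp_all

lemma left_sum_map: "left_sum F (map f u) (map f v) = left_sum (\<lambda>z. F (map f z)) u v"
  by (cases u) (simp_all add: shuffle_sum_map)

lemma right_sum_map: "right_sum F (map f u) (map f v) = right_sum (\<lambda>z. F (map f z)) u v"
  by (cases v) (simp_all add: shuffle_sum_map)

lemma shuffle_sum_cong:
  "(\<And>z. mset z = mset u + mset v \<Longrightarrow> F z = G z) \<Longrightarrow> shuffle_sum F u v = shuffle_sum G u v"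
  by (induction F u v arbitrary: G rule: shuffle_sum.induct)
    (force intro!: arg_cong2[of _ _ _ _ "(+)"] simp: add.commute)+

lemma left_sum_cong:
  assumes "\<And>z. mset z = mset u + mset v \<Longrightarrow> F z = G z"
  shows "left_sum F u v = left_sum G u v"
  using assms by (cases u) (auto intro!: shuffle_sum_cong)

lemma right_sum_cong:
  assumes "\<And>z. mset z = mset u + mset v \<Longrightarrow> F z = G z"
  shows "right_sum F u v = right_sum G u v"
  using assms by (cases v) (auto intro!: shuffle_sum_cong)

lemma shuffle_sum_shuffles:
  "set u \<inter> set v = {} \<Longrightarrow> shuffle_sum F u v = (\<Sum>z\<in>shuffles u v. F z)"
proof (induction F u v rule: shuffle_sum.induct)
  case (3 F x u y v)
  have "(\<Sum>z\<in>shuffles (x # u) (y # v). F z) =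
      (\<Sum>z\<in>(#) x ` shuffles u (y # v). F z) + (\<Sum>z\<in>(#) y ` shuffles (x # u) v. F z)"
    using "3.prems" by (simp, intro sum.union_disjoint) auto
  also have "\<dots> = (\<Sum>z\<in>shuffles u (y # v). F (x # z)) + (\<Sum>z\<in>shuffles (x # u) v. F (y # z))"
    by (simp add: sum.reindex)
  also have "\<dots> = shuffle_sum F (x # u) (y # v)"
    using "3.IH" "3.prems" by simp
  finally show ?case ..
qed auto

text \<open>
  Both sides sum over the shuffles of three lists. Sorting these by the list that supplies the
  first letter reduces the claim to three instances with one letter less.
\<close>
lemma shuffle_sum_assoc:
  fixes F :: "'a list \<Rightarrow> 'b::comm_monoid_add"
  shows "shuffle_sum (\<lambda>z. shuffle_sum F z w) u v = shuffle_sum (\<lambda>z. shuffle_sum F u z) v w"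
proof (induction "length u + length v + length w" arbitrary: u v w F rule: less_induct)
  case less
  show ?case
  proof (cases "u = [] \<or> v = [] \<or> w = []")
    case True
    then show ?thesis by auto
  next
    case False
    then obtain x u' y v' z w' where [simp]: "u = x # u'" "v = y # v'" "w = z # w'"
      by (auto simp: neq_Nil_conv)
    have 1: "shuffle_sum (\<lambda>t. shuffle_sum F t w') (x # u') (y # v')
        = shuffle_sum (\<lambda>t. shuffle_sum F (x # u') t) (y # v') w'" for F :: "'a list \<Rightarrow> 'b"
      by (rule less) simp
    have 2: "shuffle_sum (\<lambda>t. shuffle_sum F t (z # w')) (x # u') v'
        = shuffle_sum (\<lambda>t. shuffle_sum F (x # u') t) v' (z # w')" for F :: "'a list \<Rightarrow> 'b"
      by (rule less) simp
    have 3: "shuffle_sum (\<lambda>t. shuffle_sum F t (z # w')) u' (y # v')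
        = shuffle_sum (\<lambda>t. shuffle_sum F u' t) (y # v') (z # w')" for F :: "'a list \<Rightarrow> 'b"
      by (rule less) simp
    show ?thesis
      using 1[of "\<lambda>t. F (z # t)"] 2[of "\<lambda>t. F (y # t)"] 3[of "\<lambda>t. F (x # t)"]
      by (simp add: shuffle_sum_add ac_simps)
  qed
qed

text \<open>
  The three dendriform axioms at the level of lists. After removal of the first letter, which is
  taken from \<open>u\<close>, \<open>v\<close> and \<open>w\<close> respectively, each is associativity of shuffling.
\<close>
lemma left_left_sum:
  "left_sum (\<lambda>z. left_sum F z w) u v = shuffle_sum (\<lambda>z. left_sum F u z) v w"
  by (cases u) (simp_all add: shuffle_sum_assoc)

lemma right_left_sum:
  "right_sum (\<lambda>z. left_sum F z w) u v = left_sum (\<lambda>z. right_sum F u z) v w"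
  by (cases v) (simp_all add: shuffle_sum_assoc)

lemma right_right_sum:
  "shuffle_sum (\<lambda>z. right_sum F z w) u v = right_sum (\<lambda>z. right_sum F u z) v w"
  by (cases w) (simp_all add: shuffle_sum_assoc)


section \<open>Deconcatenations of lists\<close>

definition deconc_sum :: "('a list \<Rightarrow> 'a list \<Rightarrow> 'v::comm_monoid_add) \<Rightarrow> 'a list \<Rightarrow> 'v"
  where "deconc_sum G z = (\<Sum>i\<le>length z. G (take i z) (drop i z))"

lemma deconc_sum_Nil [simp]: "deconc_sum G [] = G [] []"
  by (simp add: deconc_sum_def)

lemma deconc_sum_Cons [simp]:
  "deconc_sum G (x # z) = G [] (x # z) + deconc_sum (\<lambda>p. G (x # p)) z"
  unfolding deconc_sum_def by (simp add: sum.atMost_Suc_shift del: sum.atMost_Suc)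

lemma deconc_sum_zero [simp]: "deconc_sum (\<lambda>p q. 0) z = 0"
  by (simp add: deconc_sum_def)

lemma deconc_sum_add:
  "deconc_sum (\<lambda>p q. G p q + H p q) z = deconc_sum G z + deconc_sum H z"
  by (simp add: deconc_sum_def sum.distrib)

lemma deconc_sum_cong:
  "(\<And>p q. z = p @ q \<Longrightarrow> G p q = H p q) \<Longrightarrow> deconc_sum G z = deconc_sum H z"
  unfolding deconc_sum_def by (intro sum.cong refl) simp

lemma deconc_sum_linear: "linearQ h \<Longrightarrow> h (deconc_sum G z) = deconc_sum (\<lambda>p q. h (G p q)) z"
  by (simp add: deconc_sum_def linearQ_sum)

lemma deconc_sum_coassoc:
  "deconc_sum (\<lambda>p q. deconc_sum (\<lambda>p\<^sub>1 p\<^sub>2. T p\<^sub>1 p\<^sub>2 q) p) z =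
    deconc_sum (\<lambda>p q. deconc_sum (T p) q) z"
  by (induction z arbitrary: T) (simp_all add: deconc_sum_add add.assoc)

text \<open>
  The bialgebra property of shuffling and cutting. The cut in front of a shuffle comes from the
  cuts in front of both lists. Any other cut keeps the first letter of the shuffle in the left
  factor, and induction applies once this letter is removed from the list that supplies it.
\<close>
lemma deconc_sum_shuffle:
  fixes G :: "'a list \<Rightarrow> 'a list \<Rightarrow> 'b::comm_monoid_add"
  shows "shuffle_sum (deconc_sum G) u v = deconc_sum (\<lambda>u\<^sub>1 u\<^sub>2. deconc_sum (\<lambda>v\<^sub>1 v\<^sub>2.
    shuffle_sum (\<lambda>p. shuffle_sum (G p) u\<^sub>2 v\<^sub>2) u\<^sub>1 v\<^sub>1) v) u"
proof (induction "length u + length v" arbitrary: u v G rule: less_induct)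
  case less
  show ?case
  proof (cases "u = [] \<or> v = []")
    case True
    then show ?thesis by auto
  next
    case False
    then obtain x u' y v' where [simp]: "u = x # u'" "v = y # v'"
      by (auto simp: neq_Nil_conv)
    have 1: "shuffle_sum (deconc_sum H) u' (y # v') = deconc_sum (\<lambda>u\<^sub>1 u\<^sub>2. deconc_sum (\<lambda>v\<^sub>1 v\<^sub>2.
        shuffle_sum (\<lambda>p. shuffle_sum (H p) u\<^sub>2 v\<^sub>2) u\<^sub>1 v\<^sub>1) (y # v')) u'"
      for H :: "'a list \<Rightarrow> 'a list \<Rightarrow> 'b"
      by (rule less) simp
    have 2: "shuffle_sum (deconc_sum H) (x # u') v' = deconc_sum (\<lambda>u\<^sub>1 u\<^sub>2. deconc_sum (\<lambda>v\<^sub>1 v\<^sub>2.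
        shuffle_sum (\<lambda>p. shuffle_sum (H p) u\<^sub>2 v\<^sub>2) u\<^sub>1 v\<^sub>1) v') (x # u')"
      for H :: "'a list \<Rightarrow> 'a list \<Rightarrow> 'b"
      by (rule less) simp
    show ?thesis
      using 1[of "\<lambda>p. G (x # p)"] 2[of "\<lambda>p. G (y # p)"]
      by (simp add: shuffle_sum_add deconc_sum_add ac_simps)
  qed
qed

text \<open>
  If the first letter is prescribed, it stays in the left factor unless the cut is in front of
  it. Letting \<open>G\<close> vanish on that cut keeps the half shuffle on the left factors.
\<close>
lemma deconc_sum_left:
  assumes "\<And>q. G [] q = 0"
  shows "left_sum (deconc_sum G) u v = deconc_sum (\<lambda>u\<^sub>1 u\<^sub>2. deconc_sum (\<lambda>v\<^sub>1 v\<^sub>2.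
    left_sum (\<lambda>p. shuffle_sum (G p) u\<^sub>2 v\<^sub>2) u\<^sub>1 v\<^sub>1) v) u"
  by (cases u) (simp_all add: assms deconc_sum_shuffle)

lemma deconc_sum_right:
  assumes "\<And>q. G [] q = 0"
  shows "right_sum (deconc_sum G) u v = deconc_sum (\<lambda>u\<^sub>1 u\<^sub>2. deconc_sum (\<lambda>v\<^sub>1 v\<^sub>2.
    right_sum (\<lambda>p. shuffle_sum (G p) u\<^sub>2 v\<^sub>2) u\<^sub>1 v\<^sub>1) v) u"
  by (cases v) (simp_all add: assms deconc_sum_shuffle)

text \<open>
  The coproducts of \<open>S\<^sub>+\<close> have no terms with an empty factor. \<open>deconc_sum\<close> is the better notion for
  inductions, this one for reading off the terms of a formula.
\<close>
definition proper_sum :: "('a list \<Rightarrow> 'a list \<Rightarrow> 'v::comm_monoid_add) \<Rightarrow> 'a list \<Rightarrow> 'v"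
  where "proper_sum G z = (\<Sum>i\<in>{1..<length z}. G (take i z) (drop i z))"

lemma deconc_sum_proper:
  assumes "z \<noteq> []"
  shows "deconc_sum G z = G [] z + proper_sum G z + G z []"
proof -
  have "{..length z} = insert 0 (insert (length z) {1..<length z})"
    by auto
  then show ?thesis
    using assms by (simp add: deconc_sum_def proper_sum_def ac_simps)
qed

lemma proper_sum_cong:
  assumes "\<And>p q. z = p @ q \<Longrightarrow> p \<noteq> [] \<Longrightarrow> q \<noteq> [] \<Longrightarrow> G p q = H p q"
  shows "proper_sum G z = proper_sum H z"
  unfolding proper_sum_def
proof (rule sum.cong[OF refl])
  fix i assume "i \<in> {1..<length z}"
  then have "take i z \<noteq> []" "drop i z \<noteq> []" by auto
  then show "G (take i z) (drop i z) = H (take i z) (drop i z)"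
    by (intro assms) simp_all
qed

lemma proper_sum_zero [simp]: "proper_sum (\<lambda>p q. 0) z = 0"
  by (simp add: proper_sum_def)

lemma proper_sum_add:
  "proper_sum (\<lambda>p q. G p q + H p q) z = proper_sum G z + proper_sum H z"
  by (simp add: proper_sum_def sum.distrib)

lemma proper_sum_linear: "linearQ h \<Longrightarrow> h (proper_sum G z) = proper_sum (\<lambda>p q. h (G p q)) z"
  by (simp add: proper_sum_def linearQ_sum)


section \<open>Standardization of words\<close>

definition letters :: "(nat \<times> nat) list \<Rightarrow> nat set"
  where "letters z = fst ` set z"

definition word :: "(nat \<times> nat) list \<Rightarrow> bool"
  where "word z \<longleftrightarrow> distinct (map fst z) \<and> (\<forall>p\<in>set z. snd p \<ge> 1)"

definition biword_of :: "(nat \<times> nat) list \<Rightarrow> biword"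
  where "biword_of z = Abs_biword
    (length z, std (length z) (\<lambda>i. fst (z ! (i - 1))),
     \<lambda>i. if i \<in> {1..length z} then snd (z ! (i - 1)) else 0)"

definition word_of :: "biword \<Rightarrow> (nat \<times> nat) list"
  where "word_of w = map (\<lambda>i. (perm w i, deg w i)) [1..<Suc (len w)]"

lemma letters_simps [simp]:
  "letters [] = {}" "letters (p # z) = insert (fst p) (letters z)" "letters (y @ z) = letters y \<union> letters z"
  "finite (letters z)" "letters z = {} \<longleftrightarrow> z = []"
  by (auto simp: letters_def)

lemma letters_take: "letters (take i z) \<subseteq> letters z"
  and letters_drop: "letters (drop i z) \<subseteq> letters z"
  by (auto simp: letters_def dest: in_set_takeD in_set_dropD)

lemma letters_mset: "mset z = mset u + mset v \<Longrightarrow> letters z = letters u \<union> letters v"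
  by (metis letters_def letters_simps(3) mset_append set_mset_mset)

lemma word_append:
  "word (u @ v) \<longleftrightarrow> word u \<and> word v \<and> letters u \<inter> letters v = {}"
  by (auto simp: word_def letters_def)

lemma card_letters: "word z \<Longrightarrow> card (letters z) = length z"
  unfolding letters_def word_def by (metis distinct_card length_map list.set_map)

lemma letters_image: "(\<lambda>i. fst (z ! (i - 1))) ` {1..length z} = letters z"
proof -
  have "(\<lambda>i. z ! (i - 1)) ` {1..length z} = set z"
    by (force simp: set_conv_nth image_iff intro: bexI[of _ "Suc _"])
  then show ?thesis
    unfolding letters_def by (metis image_image)
qed

text \<open>
  Standardization is unaffected by an increasing change of letters, because ranks are.
\<close>
lemma rank_image:
  assumes "strict_mono_on A f" "B \<subseteq> A" "b \<in> A"
  shows "rank (f ` B) (f b) = rank B b"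
proof -
  have le: "f a \<le> f b \<longleftrightarrow> a \<le> b" if "a \<in> B" for a
    using assms that by (meson in_mono strict_mono_on_less_eq)
  have "{c \<in> f ` B. c \<le> f b} = f ` {a \<in> B. a \<le> b}"
    using le by auto
  moreover have "inj_on f {a \<in> B. a \<le> b}"
    using assms strict_mono_on_imp_inj_on by (metis (no_types, lifting) inj_on_subset mem_Collect_eq subset_iff)
  ultimately show ?thesis
    by (simp add: rank_def card_image)
qed

lemma std_cong:
  assumes "\<And>i. i \<in> {1..m} \<Longrightarrow> u i = v i"
  shows "std m u = std m v"
proof -
  have "u ` {1..m} = v ` {1..m}"
    using assms by (rule image_cong[OF refl])
  then show ?thesis
    using assms by (auto simp only: std_def fun_eq_iff split: if_split)
qed

lemma std_strict_mono:
  assumes "strict_mono_on (u ` {1..m}) f"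
  shows "std m (\<lambda>i. f (u i)) = std m u"
  using rank_image[OF assms subset_refl] by (auto simp: std_def fun_eq_iff image_image)

lemma rank_permuted: "i \<in> {1..m} \<Longrightarrow> rank {1..m} i = i"
proof -
  assume "i \<in> {1..m}"
  then have "{b \<in> {1..m}. b \<le> i} = {1..i}" by auto
  then show ?thesis by (simp add: rank_def)
qed

lemma std_permutation:
  assumes "\<sigma> permutes {1..m}"
  shows "std m \<sigma> = \<sigma>"
proof
  fix i
  show "std m \<sigma> i = \<sigma> i"
    using assms rank_permuted[of "\<sigma> i" m] permutes_in_image[OF assms, of i]
    by (auto simp: std_def permutes_image permutes_not_in)
qed

lemma
  assumes "word z" "z \<noteq> []"
  shows len_biword_of: "len (biword_of z) = length z"
    and perm_biword_of: "i \<in> {1..length z} \<Longrightarrow> perm (biword_of z) i = rank (letters z) (fst (z ! (i - 1)))"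
    and deg_biword_of: "i \<in> {1..length z} \<Longrightarrow> deg (biword_of z) i = snd (z ! (i - 1))"
proof -
  have 1: "length z \<ge> 1"
    using assms(2) by (cases z) auto
  have "inj_on (\<lambda>i. fst (z ! (i - 1))) {1..length z}"
  proof (rule inj_onI)
    fix i j
    assume ij: "i \<in> {1..length z}" "j \<in> {1..length z}" and eq: "fst (z ! (i - 1)) = fst (z ! (j - 1))"
    then have "i - 1 < length z" "j - 1 < length z" by auto
    with eq have "map fst z ! (i - 1) = map fst z ! (j - 1)" by simp
    then have "i - 1 = j - 1"
      using assms(1) ij by (subst (asm) nth_eq_iff_index_eq) (auto simp: word_def)
    with ij show "i = j" by auto
  qed
  note 2 = std_permutes[OF this]
  have 3: "\<forall>i\<in>{1..length z}. (if i \<in> {1..length z} then snd (z ! (i - 1)) else 0) \<ge> 1"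
    using assms(1) by (auto simp: word_def)
  have 4: "\<forall>i. i \<notin> {1..length z} \<longrightarrow> (if i \<in> {1..length z} then snd (z ! (i - 1)) else 0) = 0"
    by auto
  show "len (biword_of z) = length z"
    unfolding biword_of_def by (rule len_Abs_biword[OF 1 2 3 4])
  show "perm (biword_of z) i = rank (letters z) (fst (z ! (i - 1)))" if "i \<in> {1..length z}"
    unfolding biword_of_def perm_Abs_biword[OF 1 2 3 4]
    using that by (simp add: std_def letters_image del: One_nat_def)
  show "deg (biword_of z) i = snd (z ! (i - 1))" if "i \<in> {1..length z}"
    unfolding biword_of_def deg_Abs_biword[OF 1 2 3 4] using that by simp
qed

lemma biword_of_strict_mono:
  assumes "strict_mono_on (letters z) f"
  shows "biword_of (map (apfst f) z) = biword_of z"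
proof -
  have "std (length z) (\<lambda>i. fst (map (apfst f) z ! (i - 1))) = std (length z) (\<lambda>i. f (fst (z ! (i - 1))))"
    by (rule std_cong) auto
  also have "\<dots> = std (length z) (\<lambda>i. fst (z ! (i - 1)))"
    by (rule std_strict_mono) (use assms in \<open>simp only: letters_image\<close>)
  finally have 1: "std (length z) (\<lambda>i. fst (map (apfst f) z ! (i - 1))) = std (length z) (\<lambda>i. fst (z ! (i - 1)))" .
  have 2: "(\<lambda>i. if i \<in> {1..length z} then snd (map (apfst f) z ! (i - 1)) else 0) =
      (\<lambda>i. if i \<in> {1..length z} then snd (z ! (i - 1)) else 0)"
    by (rule ext) auto
  show ?thesis
    unfolding biword_of_def length_map 1 2 ..
qed

lemma length_word_of [simp]: "length (word_of w) = len w"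
  by (simp add: word_of_def)

lemma nth_word_of: "i < len w \<Longrightarrow> word_of w ! i = (perm w (Suc i), deg w (Suc i))"
  by (simp add: word_of_def del: upt_Suc)

lemma word_of_nonempty: "word_of w \<noteq> []"
  using biword_props(1)[of w] by (metis length_word_of list.size(3) not_one_le_zero)

lemma word_word_of: "word (word_of w)"
proof -
  have "inj (perm w)"
    using biword_props(2) by (rule permutes_inj)
  then have "distinct (map (perm w) [1..<Suc (len w)])"
    by (simp add: distinct_map del: upt_Suc) (rule inj_on_subset, auto)
  then show ?thesis
    using biword_props(3)[of _ w] by (auto simp: word_def word_of_def comp_def simp del: upt_Suc)
qed

lemma factor_eq_biword_of:
  assumes "p + m \<le> len w"
  shows "factor w p m = biword_of (take m (drop p (word_of w)))"
proof -
  let ?z = "take m (drop p (word_of w))"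
  have len: "length ?z = m" using assms by simp
  have nth: "?z ! (i - 1) = (perm w (p + i), deg w (p + i))" if "i \<in> {1..m}" for i
  proof -
    have "i - 1 < m" "p + (i - 1) < len w" "Suc (p + (i - 1)) = p + i"
      using that assms by auto
    then show ?thesis
      using assms by (simp add: nth_word_of)
  qed
  have 1: "std m (\<lambda>i. fst (?z ! (i - 1))) = std m (\<lambda>i. perm w (p + i))"
    by (rule std_cong) (simp only: nth fst_conv)
  have 2: "(\<lambda>i. if i \<in> {1..m} then snd (?z ! (i - 1)) else 0) =
      (\<lambda>i. if i \<in> {1..m} then deg w (p + i) else 0)"
    by (rule ext, rule if_cong) (simp_all only: nth snd_conv)
  show ?thesis
    unfolding factor_def biword_of_def len 1 2 ..
qed

text \<open>
  A permutation is its own standardization; the biword is recovered as its factor of full length.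
\<close>
lemma biword_of_word_of: "biword_of (word_of w) = w"
proof -
  have "factor w 0 (len w) = w"
  proof (rule biword_eqI)
    have 1: "len w \<ge> 1" "0 + len w \<le> len w" using biword_props(1) by auto
    show "len (factor w 0 (len w)) = len w"
      using len_factor[OF 1] .
    show "perm (factor w 0 (len w)) = perm w"
      using perm_factor[OF 1] std_permutation[OF biword_props(2)[of w]] by simp
    show "deg (factor w 0 (len w)) = deg w"
      using deg_factor[OF 1] biword_props(4)[of _ w] by (auto simp: fun_eq_iff)
  qed
  then show ?thesis
    by (simp add: factor_eq_biword_of)
qed

lemma word_of_biword_of:
  assumes "word z" "z \<noteq> []"
  shows "word_of (biword_of z) = map (apfst (rank (letters z))) z"
  by (rule nth_equalityI)
    (simp_all add: assms len_biword_of nth_word_of perm_biword_of deg_biword_of apfst_def map_prod_def split: prod.split)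

text \<open>
  Factors may be taken before standardizing: the ranks in the whole word are an increasing
  function of the letters, so standardizing the factor undoes them.
\<close>
lemma factor_biword_of:
  assumes "word z" "p + m \<le> length z" "m \<ge> 1"
  shows "factor (biword_of z) p m = biword_of (take m (drop p z))"
proof -
  have z: "z \<noteq> []" using assms by auto
  have "factor (biword_of z) p m = biword_of (map (apfst (rank (letters z))) (take m (drop p z)))"
    using assms z
    by (simp add: factor_eq_biword_of len_biword_of word_of_biword_of take_map drop_map)
  also have "\<dots> = biword_of (take m (drop p z))"
  proof (rule biword_of_strict_mono)
    have "letters (take m (drop p z)) \<subseteq> letters z"
      using letters_take letters_drop by blast
    then show "strict_mono_on (letters (take m (drop p z))) (rank (letters z))"
      using strict_mono_on_rank[of "letters z"] by (auto intro: monotone_on_subset)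
  qed
  finally show ?thesis .
qed

text \<open>
  The value \<open>0\<close> at the empty word, which is no biword, lets the improper cuts of a word drop out
  of the coproducts by themselves.
\<close>
definition biword_vec :: "(nat \<times> nat) list \<Rightarrow> Splus"  (\<open>\<langle>_\<rangle>\<close>)
  where "\<langle>z\<rangle> = (if z = [] then 0 else basis_vec (biword_of z))"

lemma biword_vec_Nil [simp]: "\<langle>[]\<rangle> = 0"
  by (simp add: biword_vec_def)

lemma biword_vec_word_of: "\<langle>word_of w\<rangle> = basis_vec w"
  by (simp add: biword_vec_def word_of_nonempty biword_of_word_of)

lemma biword_vec_strict_mono: "strict_mono_on (letters z) f \<Longrightarrow> \<langle>map (apfst f) z\<rangle> = \<langle>z\<rangle>"
  by (simp add: biword_vec_def biword_of_strict_mono)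


section \<open>Coproducts of words\<close>

lemma rank_eq_1_iff:
  assumes "finite A" "a \<in> A"
  shows "rank A a = 1 \<longleftrightarrow> a = Min A"
proof
  assume "rank A a = 1"
  then obtain c where c: "{b \<in> A. b \<le> a} = {c}"
    unfolding rank_def by (metis card_1_singletonE One_nat_def)
  have "Min A \<in> {b \<in> A. b \<le> a}" "a \<in> {b \<in> A. b \<le> a}"
    using assms by (auto intro: Min_in)
  with c show "a = Min A" by auto
next
  assume "a = Min A"
  then have "{b \<in> A. b \<le> a} = {a}"
    using assms by (auto intro: antisym)
  then show "rank A a = 1" by (simp add: rank_def)
qed

text \<open>
  The letter of rank \<open>1\<close> is the smallest one, so the position of \<open>1\<close> in the standardization is
  that of the smallest letter.
\<close>
lemma Min_letters_in_take_iff: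
  assumes "word z" "z \<noteq> []" "i \<le> length z"
  shows "Min (letters z) \<in> letters (take i z) \<longleftrightarrow> inv (perm (biword_of z)) 1 \<le> i"
proof -
  let ?\<sigma> = "perm (biword_of z)" and ?n = "length z"
  have \<sigma>: "?\<sigma> permutes {1..?n}"
    using biword_props(2)[of "biword_of z"] assms by (simp add: len_biword_of)
  define p where "p = inv ?\<sigma> 1"
  have p: "?\<sigma> p = 1"
    unfolding p_def using permutes_inverses(1)[OF \<sigma>] .
  have n: "?n \<ge> 1" using assms(2) by (cases z) auto
  then have pn: "p \<in> {1..?n}"
    unfolding p_def using permutes_in_image[OF permutes_inv[OF \<sigma>], of 1] by simp
  have in1: "fst (z ! (p - 1)) \<in> letters z"
    using pn by (auto simp: letters_def)
  have "Min (letters z) = fst (z ! (p - 1))"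
    using p pn assms rank_eq_1_iff[OF _ in1] by (simp add: perm_biword_of)
  also have "\<dots> = map fst z ! (p - 1)"
    using pn by (subst nth_map) auto
  finally have min: "Min (letters z) = map fst z ! (p - 1)" .
  have "letters (take i z) = set (take i (map fst z))"
    by (simp add: letters_def take_map)
  then have "Min (letters z) \<in> letters (take i z) \<longleftrightarrow> (\<exists>j<i. map fst z ! (p - 1) = map fst z ! j)"
    using assms(3) unfolding min by (auto simp: in_set_conv_nth simp del: nth_map)
  also have "\<dots> \<longleftrightarrow> (\<exists>j<i. p - 1 = j)"
    using assms pn by (intro ex_cong1 conj_cong refl nth_eq_iff_index_eq) (auto simp: word_def)
  also have "\<dots> \<longleftrightarrow> p \<le> i"
    using pn by auto
  finally show ?thesis unfolding p_def .
qed

lemma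
  assumes "word z" "z \<noteq> []"
  shows basis_factor_left: "i \<in> {1..length z - 1} \<Longrightarrow> basis_vec (factor (biword_of z) 0 i) = \<langle>take i z\<rangle>"
    and basis_factor_right:
      "i \<in> {1..length z - 1} \<Longrightarrow> basis_vec (factor (biword_of z) i (length z - i)) = \<langle>drop i z\<rangle>"
  using assms by (auto simp: biword_vec_def factor_biword_of)

lemma S_cprec_word:
  assumes "word z"
  shows "\<Delta>\<^sub>\<prec> \<langle>z\<rangle> = deconc_sum (\<lambda>p q. if Min (letters z) \<in> letters p then \<langle>p\<rangle> \<otimes> \<langle>q\<rangle> else 0) z"
proof (cases "z = []")
  case True
  then show ?thesis
    by (simp add: S_cprec_def linearQ_zero[OF linearQ_lin_ext] tensor_zero)
next
  case False
  let ?n = "length z" and ?p = "inv (perm (biword_of z)) 1"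
  have n: "?n \<ge> 1" using False by (cases z) auto
  have p: "?p \<ge> 1"
    using Min_letters_in_take_iff[OF assms False, of 0] by simp
  have "\<Delta>\<^sub>\<prec> \<langle>z\<rangle> = (\<Sum>i\<in>{?p..?n - 1}. \<langle>take i z\<rangle> \<otimes> \<langle>drop i z\<rangle>)"
    using assms False p
    by (auto simp: S_cprec_def biword_vec_def[of z] len_biword_of intro!: sum.cong
        simp flip: basis_factor_left basis_factor_right)
  also have "\<dots> = deconc_sum (\<lambda>p q. if Min (letters z) \<in> letters p then \<langle>p\<rangle> \<otimes> \<langle>q\<rangle> else 0) z"
    unfolding deconc_sum_def
  proof (rule sum.mono_neutral_cong_left)
    show "\<forall>i\<in>{..?n} - {?p..?n - 1}.
        (if Min (letters z) \<in> letters (take i z) then \<langle>take i z\<rangle> \<otimes> \<langle>drop i z\<rangle> else 0) = 0"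
      using n p assms False by (auto simp: Min_letters_in_take_iff tensor_zero not_le less_Suc_eq_le)
  qed (use n in \<open>auto simp: Min_letters_in_take_iff assms False\<close>)
  finally show ?thesis .
qed

lemma S_csucc_word:
  assumes "word z"
  shows "\<Delta>\<^sub>\<succ> \<langle>z\<rangle> = deconc_sum (\<lambda>p q. if Min (letters z) \<notin> letters p then \<langle>p\<rangle> \<otimes> \<langle>q\<rangle> else 0) z"
proof (cases "z = []")
  case True
  then show ?thesis
    by (simp add: S_csucc_def linearQ_zero[OF linearQ_lin_ext] tensor_zero)
next
  case False
  let ?n = "length z" and ?p = "inv (perm (biword_of z)) 1"
  have p: "?p \<le> ?n"
    using Min_letters_in_take_iff[OF assms False, of ?n] False by simp
  have "\<Delta>\<^sub>\<succ> \<langle>z\<rangle> = (\<Sum>i\<in>{1..?p - 1}. \<langle>take i z\<rangle> \<otimes> \<langle>drop i z\<rangle>)"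
    using assms False p
    by (auto simp: S_csucc_def biword_vec_def[of z] len_biword_of intro!: sum.cong
        simp flip: basis_factor_left basis_factor_right)
  also have "\<dots> = deconc_sum (\<lambda>p q. if Min (letters z) \<notin> letters p then \<langle>p\<rangle> \<otimes> \<langle>q\<rangle> else 0) z"
    unfolding deconc_sum_def
  proof (rule sum.mono_neutral_cong_left)
    show "\<forall>i\<in>{..?n} - {1..?p - 1}.
        (if Min (letters z) \<notin> letters (take i z) then \<langle>take i z\<rangle> \<otimes> \<langle>drop i z\<rangle> else 0) = 0"
      using assms False by (auto simp: Min_letters_in_take_iff tensor_zero not_le less_Suc_eq_le)
  qed (use p in \<open>auto simp: Min_letters_in_take_iff assms False\<close>)
  finally show ?thesis .
qed

text \<open>
  The truth value says whether the smallest letter lies in the left factor; with it as a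
  parameter, both coproducts are treated at once.
\<close>
definition S_coprod :: "bool \<Rightarrow> Splus \<Rightarrow> Splus \<otimes> Splus"
  where "S_coprod b = (if b then S_cprec else S_csucc)"

lemma linearQ_S_coprod: "linearQ (S_coprod b)"
  by (simp add: S_coprod_def S_cprec_def S_csucc_def linearQ_lin_ext)

lemma linearQ_S_ctotal: "linearQ \<Delta>"
  using linearQ_S_coprod[of True] linearQ_S_coprod[of False]
  by (simp add: linearQ_iff S_ctotal_def S_coprod_def scaleQ_add_right algebra_simps)

lemma
  shows S_coprod_add: "S_coprod b (x + y) = S_coprod b x + S_coprod b y"
    and S_coprod_scale: "S_coprod b (c *\<^sub>Q x) = c *\<^sub>Q S_coprod b x"
    and S_ctotal_add: "\<Delta> (x + y) = \<Delta> x + \<Delta> y"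
    and S_ctotal_scale: "\<Delta> (c *\<^sub>Q x) = c *\<^sub>Q \<Delta> x"
  using linearQ_S_coprod[of b] linearQ_S_ctotal by (auto simp: linearQ_iff)

lemma S_coprod_word:
  "word z \<Longrightarrow> S_coprod b \<langle>z\<rangle> =
    deconc_sum (\<lambda>p q. if (Min (letters z) \<in> letters p) = b then \<langle>p\<rangle> \<otimes> \<langle>q\<rangle> else 0) z"
  by (simp add: S_coprod_def S_cprec_word S_csucc_word)

lemma S_ctotal_word: "word z \<Longrightarrow> \<Delta> \<langle>z\<rangle> = deconc_sum (\<lambda>p q. \<langle>p\<rangle> \<otimes> \<langle>q\<rangle>) z"
  unfolding S_ctotal_def S_cprec_word S_csucc_word deconc_sum_add[symmetric]
  by (rule deconc_sum_cong) simp

lemma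
  assumes "word z" "z \<noteq> []"
  shows S_coprod_proper: "S_coprod b \<langle>z\<rangle> =
      proper_sum (\<lambda>p q. if (Min (letters z) \<in> letters p) = b then \<langle>p\<rangle> \<otimes> \<langle>q\<rangle> else 0) z"
    and S_ctotal_proper: "\<Delta> \<langle>z\<rangle> = proper_sum (\<lambda>p q. \<langle>p\<rangle> \<otimes> \<langle>q\<rangle>) z"
  using assms by (simp_all add: S_coprod_word S_ctotal_word deconc_sum_proper tensor_zero)


section \<open>Products of words\<close>

lemma in_shuffles_iff:
  assumes "set u \<inter> set v = {}"
  shows "z \<in> shuffles u v \<longleftrightarrow> set z = set u \<union> set v \<and>
    filter (\<lambda>x. x \<in> set u) z = u \<and> filter (\<lambda>x. x \<in> set v) z = v"
proof
  assume "z \<in> shuffles u v"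
  then show "set z = set u \<union> set v \<and> filter (\<lambda>x. x \<in> set u) z = u \<and> filter (\<lambda>x. x \<in> set v) z = v"
    using filter_shuffles_disjoint1[OF assms] filter_shuffles_disjoint2[OF assms] set_shuffles by metis
next
  assume *: "set z = set u \<union> set v \<and> filter (\<lambda>x. x \<in> set u) z = u \<and> filter (\<lambda>x. x \<in> set v) z = v"
  have "filter (\<lambda>x. x \<notin> set u) z = filter (\<lambda>x. x \<in> set v) z"
    using * assms by (intro filter_cong) auto
  then show "z \<in> shuffles u v"
    using partition_in_shuffles[of z "\<lambda>x. x \<in> set u"] * by simp
qed

lemma sorted_wrt_filter_iff:
  "sorted_wrt R (filter P xs) \<longleftrightarrow> sorted_wrt (\<lambda>x y. P x \<longrightarrow> P y \<longrightarrow> R x y) xs"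
  by (induction xs) auto

text \<open>
  The word of \<open>inv \<alpha>\<close> lists at position \<open>\<alpha> x\<close> the number \<open>x\<close>. Hence \<open>\<alpha>\<close> is increasing on an
  interval iff the elements of the interval appear in increasing order in that word.
\<close>
lemma filter_inverse_list_iff:
  assumes "\<alpha> permutes {1..n}" "{a..<b} \<subseteq> {1..n}"
  shows "filter (\<lambda>x. x \<in> {a..<b}) (map (inv \<alpha>) [1..<Suc n]) = [a..<b] \<longleftrightarrow> strict_mono_on {a..<b} \<alpha>"
proof -
  let ?xs = "filter (\<lambda>x. x \<in> {a..<b}) (map (inv \<alpha>) [1..<Suc n])"
  have inv: "inv \<alpha> permutes {1..n}"
    using assms(1) by (rule permutes_inv)
  have "{1..<Suc n} = {1..n}" by auto
  then have "set ?xs = {a..<b}"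
    using assms(2) permutes_image[OF inv] by (auto simp del: upt_Suc)
  then have "?xs = [a..<b] \<longleftrightarrow> sorted_wrt (<) ?xs"
    using strict_sorted_equal[of ?xs "[a..<b]"] by (metis set_upt sorted_wrt_upt)
  also have "\<dots> \<longleftrightarrow> (\<forall>i\<in>{1..n}. \<forall>j\<in>{1..n}. i < j \<longrightarrow>
      inv \<alpha> i \<in> {a..<b} \<longrightarrow> inv \<alpha> j \<in> {a..<b} \<longrightarrow> inv \<alpha> i < inv \<alpha> j)"
    (is "_ \<longleftrightarrow> ?R")
  proof -
    have "sorted_wrt (<) ?xs \<longleftrightarrow> (\<forall>i j. i < j \<longrightarrow> j < n \<longrightarrow>
      inv \<alpha> (Suc i) \<in> {a..<b} \<longrightarrow> inv \<alpha> (Suc j) \<in> {a..<b} \<longrightarrow> inv \<alpha> (Suc i) < inv \<alpha> (Suc j))"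
      unfolding sorted_wrt_filter_iff unfolding sorted_wrt_iff_nth_less
      by (auto simp del: upt_Suc)
    also have "\<dots> \<longleftrightarrow> ?R"
    proof
      assume L: "\<forall>i j. i < j \<longrightarrow> j < n \<longrightarrow>
        inv \<alpha> (Suc i) \<in> {a..<b} \<longrightarrow> inv \<alpha> (Suc j) \<in> {a..<b} \<longrightarrow> inv \<alpha> (Suc i) < inv \<alpha> (Suc j)"
      show ?R
      proof (intro ballI impI)
        fix i j assume "i \<in> {1..n}" "j \<in> {1..n}" "i < j" "inv \<alpha> i \<in> {a..<b}" "inv \<alpha> j \<in> {a..<b}"
        then show "inv \<alpha> i < inv \<alpha> j"
          using L[rule_format, of "i - 1" "j - 1"] by auto
      qed
    qed auto
    finally show ?thesis .
  qed
  also have "\<dots> \<longleftrightarrow> strict_mono_on {a..<b} \<alpha>"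
  proof
    assume R: ?R
    show "strict_mono_on {a..<b} \<alpha>"
    proof (rule strict_mono_onI, rule ccontr)
      fix x y assume xy: "x \<in> {a..<b}" "y \<in> {a..<b}" "x < y" and "\<not> \<alpha> x < \<alpha> y"
      moreover have "\<alpha> x \<noteq> \<alpha> y"
        using permutes_inj[OF assms(1)] xy(3) by (auto simp: inj_eq)
      ultimately have "\<alpha> y < \<alpha> x" by simp
      moreover have "\<alpha> x \<in> {1..n}" "\<alpha> y \<in> {1..n}"
        using xy assms(2) permutes_in_image[OF assms(1)] by blast+
      ultimately have "y < x"
        using R[rule_format, of "\<alpha> y" "\<alpha> x"] xy permutes_inverses(2)[OF assms(1)] by simp
      with xy(3) show False by simp
    qed
  next
    assume mono: "strict_mono_on {a..<b} \<alpha>"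
    show ?R
    proof (intro ballI impI, rule ccontr)
      fix i j assume ij: "i < j" "inv \<alpha> i \<in> {a..<b}" "inv \<alpha> j \<in> {a..<b}" "\<not> inv \<alpha> i < inv \<alpha> j"
      then have "\<alpha> (inv \<alpha> j) \<le> \<alpha> (inv \<alpha> i)"
        using strict_mono_on_leD[OF mono] by simp
      with ij(1) show False
        using permutes_inverses(1)[OF assms(1)] by simp
    qed
  qed
  finally show ?thesis .
qed

lemma shuffle_perms_iff:
  assumes "\<alpha> permutes {1..k + l}"
  shows "\<alpha> \<in> shuffle_perms k l \<longleftrightarrow>
    map (inv \<alpha>) [1..<Suc (k + l)] \<in> shuffles [1..<Suc k] [Suc k..<Suc (k + l)]"
proof -
  have inv: "inv \<alpha> permutes {1..k + l}"
    using assms by (rule permutes_inv)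
  have sets: "{1..k} = {1..<Suc k}" "{k + 1..k + l} = {Suc k..<Suc (k + l)}" by auto
  have "inv \<alpha> ` {1..<Suc (k + l)} = {1..<Suc k} \<union> {Suc k..<Suc (k + l)}"
    using permutes_image[OF inv] by (auto simp: atLeastLessThanSuc_atLeastAtMost)
  moreover have "{1..<Suc k} \<inter> {Suc k..<Suc (k + l)} = {}" by auto
  moreover have "{1..<Suc k} \<subseteq> {1..k + l}" "{Suc k..<Suc (k + l)} \<subseteq> {1..k + l}" by auto
  ultimately show ?thesis
    using assms by (subst in_shuffles_iff)
      (simp_all only: shuffle_perms_def sets mem_Collect_eq filter_inverse_list_iff set_upt set_map simp_thms)
qed

lemma permutation_of_list:
  assumes "distinct z" "set z = {1..n}"
  defines "\<beta> \<equiv> \<lambda>i. if i \<in> {1..n} then z ! (i - 1) else i"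
  shows "\<beta> permutes {1..n}" "map \<beta> [1..<Suc n] = z"
proof -
  have len: "length z = n"
    using distinct_card[OF assms(1)] assms(2) by simp
  have "bij_betw (\<lambda>i. i - 1) {1..n} {..<n}"
    by (rule bij_betw_byWitness[where f' = Suc]) auto
  then have "bij_betw ((!) z \<circ> (\<lambda>i. i - 1)) {1..n} {1..n}"
    using bij_betw_nth[OF assms(1) _ refl] len assms(2) by (metis bij_betw_trans lessThan_iff)
  then have "bij_betw \<beta> {1..n} {1..n}"
    by (subst bij_betw_cong[of _ _ "(!) z \<circ> (\<lambda>i. i - 1)"]) (auto simp: \<beta>_def)
  then show "\<beta> permutes {1..n}"
    by (rule bij_imp_permutes) (auto simp: \<beta>_def)
  show "map \<beta> [1..<Suc n] = z"
    by (rule nth_equalityI) (auto simp: \<beta>_def len simp del: upt_Suc)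
qed

lemma sum_shuffle_perms:
  "(\<Sum>\<alpha>\<in>shuffle_perms k l. F (map (inv \<alpha>) [1..<Suc (k + l)])) =
    shuffle_sum F [1..<Suc k] [Suc k..<Suc (k + l)]"
proof -
  let ?n = "k + l" and ?u = "[1..<Suc k]" and ?v = "[Suc k..<Suc (k + l)]"
  \<comment> \<open>The permutation with list of values \<open>z\<close>; positions in a list start at \<open>0\<close>.\<close>
  define perm_of where "perm_of z = (\<lambda>i. if i \<in> {1..?n} then z ! (i - 1) else i)" for z :: "nat list"
  have disj: "set ?u \<inter> set ?v = {}" by auto
  have "(\<Sum>\<alpha>\<in>shuffle_perms k l. F (map (inv \<alpha>) [1..<Suc ?n])) = (\<Sum>z\<in>shuffles ?u ?v. F z)"
  proof (rule sum.reindex_bij_witness[where j = "\<lambda>\<alpha>. map (inv \<alpha>) [1..<Suc ?n]" and i = "\<lambda>z. inv (perm_of z)"])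
    fix \<alpha> assume \<alpha>: "\<alpha> \<in> shuffle_perms k l"
    then have perm: "\<alpha> permutes {1..?n}" by (simp add: shuffle_perms_def)
    then show "map (inv \<alpha>) [1..<Suc ?n] \<in> shuffles ?u ?v"
      using \<alpha> shuffle_perms_iff by blast
    have "perm_of (map (inv \<alpha>) [1..<Suc ?n]) = inv \<alpha>"
      using permutes_not_in[OF permutes_inv[OF perm]] by (auto simp: perm_of_def fun_eq_iff simp del: upt_Suc)
    then show "inv (perm_of (map (inv \<alpha>) [1..<Suc ?n])) = \<alpha>"
      using permutes_inv_inv[OF perm] by simp
  next
    fix z assume z: "z \<in> shuffles ?u ?v"
    have 1: "distinct z"
      using distinct_disjoint_shuffles[OF _ _ disj z] by simp
    have "set z = {1..<Suc k} \<union> {Suc k..<Suc ?n}"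
      using set_shuffles[OF z] by (simp only: set_upt)
    then have 2: "set z = {1..?n}" by auto
    note p = permutation_of_list[OF 1 2, folded perm_of_def]
    show eq: "map (inv (inv (perm_of z))) [1..<Suc ?n] = z"
      using p permutes_inv_inv by metis
    show "inv (perm_of z) \<in> shuffle_perms k l"
      using z shuffle_perms_iff[OF permutes_inv[OF p(1)]] eq by simp
  qed simp
  then show ?thesis
    using shuffle_sum_shuffles[OF disj, of F] by simp
qed

definition below :: "(nat \<times> nat) list \<Rightarrow> (nat \<times> nat) list \<Rightarrow> bool"
  where "below u v \<longleftrightarrow> (\<forall>a\<in>letters u. \<forall>b\<in>letters v. a < b)"

text \<open>
  The letters of the biword \<open>\<sigma> \<otimes> \<tau>\<close> together with their degrees; the shuffles of two biwords
  rearrange them.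
\<close>
definition concat_letter :: "biword \<Rightarrow> biword \<Rightarrow> nat \<Rightarrow> nat \<times> nat"
  where "concat_letter v w i =
    (perm_tensor (len v) (len w) (perm v) (perm w) i, deg_tensor (len v) (deg v) (deg w) i)"

lemma basis_shuffle_biword:
  assumes "\<alpha> \<in> shuffle_perms (len v) (len w)"
  shows "basis_vec (shuffle_biword v w \<alpha>) =
    \<langle>map (concat_letter v w) (map (inv \<alpha>) [1..<Suc (len v + len w)])\<rangle>"
proof -
  have \<alpha>: "\<alpha> permutes {1..len v + len w}"
    using assms by (simp add: shuffle_perms_def)
  have "word_of (shuffle_biword v w \<alpha>) =
      map (concat_letter v w) (map (inv \<alpha>) [1..<Suc (len v + len w)])"
    unfolding word_of_def len_shuffle_biword[OF \<alpha>] perm_shuffle_biword[OF \<alpha>] deg_shuffle_biword[OF \<alpha>]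
    by (simp add: concat_letter_def)
  then show ?thesis
    using biword_vec_word_of by metis
qed

text \<open>
  When \<open>u\<close> lies below \<open>v\<close>, shifting the standardization of \<open>v\<close> by the length of \<open>u\<close> amounts to
  standardizing the concatenation of \<open>u\<close> and \<open>v\<close>.
\<close>
lemma map_concat_letter:
  assumes u: "word u" "u \<noteq> []" and v: "word v" "v \<noteq> []" and uv: "below u v"
  defines "f \<equiv> rank (letters (u @ v))"
  shows "map (concat_letter (biword_of u) (biword_of v)) [1..<Suc (length u)] = map (apfst f) u"
    and "map (concat_letter (biword_of u) (biword_of v)) [Suc (length u)..<Suc (length u + length v)] =
      map (apfst f) v"
proof -
  have 1: "f a = rank (letters u) a" if "a \<in> letters u" for a
  proof -
    have "{b \<in> letters (u @ v). b \<le> a} = {b \<in> letters u. b \<le> a}"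
      using uv that by (auto simp: below_def) (meson leD)
    then show ?thesis by (simp add: f_def rank_def)
  qed
  have 2: "f b = length u + rank (letters v) b" if "b \<in> letters v" for b
  proof -
    have "{a \<in> letters (u @ v). a \<le> b} = letters u \<union> {a \<in> letters v. a \<le> b}"
      using uv that by (auto simp: below_def intro: less_imp_le)
    moreover have "letters u \<inter> {a \<in> letters v. a \<le> b} = {}"
      using uv by (auto simp: below_def)
    ultimately show ?thesis
      by (simp add: f_def rank_def card_Un_disjoint card_letters[OF u(1)])
  qed
  have nth: "i < length z \<Longrightarrow> fst (z ! i) \<in> letters z" for i z
    by (auto simp: letters_def)
  show "map (concat_letter (biword_of u) (biword_of v)) [1..<Suc (length u)] = map (apfst f) u"
    by (rule nth_equalityI)
      (simp_all add: concat_letter_def perm_tensor_def deg_tensor_def u v len_biword_of perm_biword_of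
        deg_biword_of 1 nth prod_eq_iff del: upt_Suc)
  show "map (concat_letter (biword_of u) (biword_of v)) [Suc (length u)..<Suc (length u + length v)] =
      map (apfst f) v"
    by (rule nth_equalityI)
      (simp_all add: concat_letter_def perm_tensor_def deg_tensor_def u v len_biword_of perm_biword_of
        deg_biword_of 2 nth prod_eq_iff del: upt_Suc)
qed

lemma biword_vec_shuffle:
  assumes "mset z = mset u + mset v"
  shows "\<langle>map (apfst (rank (letters (u @ v)))) z\<rangle> = \<langle>z\<rangle>"
  using letters_mset[OF assms] strict_mono_on_rank[of "letters (u @ v)"]
  by (intro biword_vec_strict_mono) simp

lemma bilinearQ_lin_ext2: "bilinearQ (\<lambda>x y. lin_ext (\<lambda>v. lin_ext (g v) y) x)"
proof -
  have "linearQ (\<lambda>y. lin_ext (\<lambda>v. lin_ext (g v) y) x)" for x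
    using linearQ_lin_ext[of "g _"] unfolding lin_ext_def[of _ x]
    by (auto simp: linearQ_iff scaleQ_add_right sum.distrib rat_vector.scale_sum_right scaleQ_scaleQ
        mult.commute)
  then show ?thesis
    by (simp add: bilinearQ_def linearQ_lin_ext)
qed

lemma bilinearQ_S_prec: "bilinearQ (\<prec>)" and bilinearQ_S_succ: "bilinearQ (\<succ>)"
  unfolding S_prec_def[abs_def] S_succ_def[abs_def] by (rule bilinearQ_lin_ext2)+

text \<open>
  The conditions \<open>inv \<alpha> 1 = 1\<close> and \<open>inv \<alpha> 1 = k + 1\<close> select the shuffles of positions that begin with
  the first position of \<open>u\<close>, respectively of \<open>v\<close>. Every shuffle is then relabelled by one
  increasing map, which does not change its basis vector.
\<close>
lemma
  assumes u: "word u" "u \<noteq> []" and v: "word v" "v \<noteq> []" and uv: "below u v"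
  shows S_prec_word: "\<langle>u\<rangle> \<prec> \<langle>v\<rangle> = left_sum biword_vec u v"
    and S_succ_word: "\<langle>u\<rangle> \<succ> \<langle>v\<rangle> = right_sum biword_vec u v"
proof -
  let ?k = "length u" and ?l = "length v" and ?c = "concat_letter (biword_of u) (biword_of v)"
  let ?x = "[1..<Suc ?k]" and ?y = "[Suc ?k..<Suc (?k + ?l)]"
  have len: "len (biword_of u) = ?k" "len (biword_of v) = ?l"
    using u v by (simp_all add: len_biword_of)
  have vec: "\<langle>u\<rangle> = basis_vec (biword_of u)" "\<langle>v\<rangle> = basis_vec (biword_of v)"
    using u v by (simp_all add: biword_vec_def)
  have x: "?x = 1 # [2..<Suc ?k]"
    using u(2) by (simp add: upt_rec numeral_2_eq_2 del: upt_Suc)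
  have y: "?y = Suc ?k # [Suc (Suc ?k)..<Suc (?k + ?l)]"
    using v(2) by (simp add: upt_rec del: upt_Suc)
  have hd: "hd (map f [1..<Suc (?k + ?l)]) = f 1" for f :: "nat \<Rightarrow> nat"
    using u(2) by (simp add: upt_rec del: upt_Suc)
  have sum: "(\<Sum>\<alpha>\<in>{\<alpha> \<in> shuffle_perms ?k ?l. inv \<alpha> 1 = h}. basis_vec (shuffle_biword (biword_of u) (biword_of v) \<alpha>)) =
      shuffle_sum (\<lambda>z. if hd z = h then \<langle>map ?c z\<rangle> else 0) ?x ?y" for h
  proof -
    have "(\<Sum>\<alpha>\<in>{\<alpha> \<in> shuffle_perms ?k ?l. inv \<alpha> 1 = h}. basis_vec (shuffle_biword (biword_of u) (biword_of v) \<alpha>)) =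
      (\<Sum>\<alpha>\<in>{\<alpha> \<in> shuffle_perms ?k ?l. inv \<alpha> 1 = h}. \<langle>map ?c (map (inv \<alpha>) [1..<Suc (?k + ?l)])\<rangle>)"
      by (rule sum.cong) (simp_all add: basis_shuffle_biword len del: upt_Suc map_map)
    also have "\<dots> = (\<Sum>\<alpha>\<in>shuffle_perms ?k ?l.
        if inv \<alpha> 1 = h then \<langle>map ?c (map (inv \<alpha>) [1..<Suc (?k + ?l)])\<rangle> else 0)"
      by (rule sum.inter_filter[OF finite_shuffle_perms])
    also have "\<dots> = shuffle_sum (\<lambda>z. if hd z = h then \<langle>map ?c z\<rangle> else 0) ?x ?y"
      unfolding sum_shuffle_perms[symmetric] hd ..
    finally show ?thesis .
  qed
  have "\<langle>u\<rangle> \<prec> \<langle>v\<rangle> = shuffle_sum (\<lambda>z. if hd z = 1 then \<langle>map ?c z\<rangle> else 0) ?x ?y"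
    by (simp only: S_prec_def vec lin_ext_basis_vec len sum)
  also have "\<dots> = left_sum (\<lambda>z. \<langle>map ?c z\<rangle>) ?x ?y"
    unfolding x y using u(2) by simp
  also have "\<dots> = left_sum biword_vec u v"
    unfolding left_sum_map[symmetric] map_concat_letter[OF u v uv]
    unfolding left_sum_map by (rule left_sum_cong) (simp add: biword_vec_shuffle del: letters_simps)
  finally show "\<langle>u\<rangle> \<prec> \<langle>v\<rangle> = left_sum biword_vec u v" .
  have "\<langle>u\<rangle> \<succ> \<langle>v\<rangle> = shuffle_sum (\<lambda>z. if hd z = ?k + 1 then \<langle>map ?c z\<rangle> else 0) ?x ?y"
    by (simp only: S_succ_def vec lin_ext_basis_vec len sum)
  also have "\<dots> = right_sum (\<lambda>z. \<langle>map ?c z\<rangle>) ?x ?y"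
    unfolding x y using u(2) by simp
  also have "\<dots> = right_sum biword_vec u v"
    unfolding right_sum_map[symmetric] map_concat_letter[OF u v uv]
    unfolding right_sum_map by (rule right_sum_cong) (simp add: biword_vec_shuffle del: letters_simps)
  finally show "\<langle>u\<rangle> \<succ> \<langle>v\<rangle> = right_sum biword_vec u v" .
qed

lemma S_star_word:
  assumes "word u" "u \<noteq> []" "word v" "v \<noteq> []" "below u v"
  shows "\<langle>u\<rangle> \<star> \<langle>v\<rangle> = shuffle_sum biword_vec u v"
  using assms by (simp add: S_star_def S_prec_word S_succ_word shuffle_sum_split)

lemma bilinearQ_S_star: "bilinearQ (\<star>)"
  using bilinearQ_S_prec bilinearQ_S_succ
  by (simp add: bilinearQ_iff S_star_def[abs_def] scaleQ_add_right algebra_simps)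

lemmas product_bilinear =
  bilinearQ_add_left[OF bilinearQ_S_prec] bilinearQ_add_right[OF bilinearQ_S_prec]
  bilinearQ_scale_left[OF bilinearQ_S_prec] bilinearQ_scale_right[OF bilinearQ_S_prec]
  bilinearQ_add_left[OF bilinearQ_S_succ] bilinearQ_add_right[OF bilinearQ_S_succ]
  bilinearQ_scale_left[OF bilinearQ_S_succ] bilinearQ_scale_right[OF bilinearQ_S_succ]
  bilinearQ_add_left[OF bilinearQ_S_star] bilinearQ_add_right[OF bilinearQ_S_star]
  bilinearQ_scale_left[OF bilinearQ_S_star] bilinearQ_scale_right[OF bilinearQ_S_star]

lemmas product_slots = bilinearQ_tensor_slots[OF bilinearQ_S_prec bilinearQ_S_star]
  bilinearQ_tensor_slots[OF bilinearQ_S_succ bilinearQ_S_star]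
  bilinearQ_tensor_slots[OF bilinearQ_S_star bilinearQ_S_prec]
  bilinearQ_tensor_slots[OF bilinearQ_S_star bilinearQ_S_succ]

lemma word_shuffle:
  assumes "mset z = mset u + mset v" "word u" "word v" "below u v"
  shows "word z"
proof -
  have "letters u \<inter> letters v = {}"
    using assms(4) by (auto simp: below_def)
  then have "word (u @ v)"
    using assms(2,3) by (simp add: word_append)
  moreover have "mset (map fst z) = mset (map fst (u @ v))" "set z = set (u @ v)"
    using assms(1) by (simp, metis mset_append set_mset_mset)
  ultimately show ?thesis
    unfolding word_def by (metis mset_eq_imp_distinct_iff)
qed

lemma Min_letters_shuffle:
  assumes "mset z = mset u + mset v" "u \<noteq> []" "below u v"
  shows "Min (letters z) = Min (letters u)"
proof (rule Min_eqI)
  show "Min (letters u) \<in> letters z"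
    using assms(2) Min_in[of "letters u"] by (simp add: letters_mset[OF assms(1)])
  show "Min (letters u) \<le> a" if "a \<in> letters z" for a
    using that assms(2,3) Min_in[of "letters u"]
    by (auto simp: letters_mset[OF assms(1)] below_def less_imp_le)
qed simp

lemma shuffle_nonempty: "mset z = mset u + mset v \<Longrightarrow> z = [] \<longleftrightarrow> u = [] \<and> v = []"
  by auto

lemma below_append:
  "below (u @ u') v \<longleftrightarrow> below u v \<and> below u' v" "below u (v @ v') \<longleftrightarrow> below u v \<and> below u v'"
  by (auto simp: below_def)

lemma below_shuffle:
  assumes "mset z = mset u + mset v"
  shows "below z w \<longleftrightarrow> below u w \<and> below v w" "below w z \<longleftrightarrow> below w u \<and> below w v"
  by (auto simp: below_def letters_mset[OF assms])

text \<open>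
  Shifting the letters of a biword upwards yields a representative above any given word. So
  identities that are multilinear need only be checked on words that lie below one another.
\<close>
lemma word_above:
  obtains u where "word u" "u \<noteq> []" "\<langle>u\<rangle> = basis_vec w" "\<And>a. a \<in> letters u \<Longrightarrow> n < a"
proof
  let ?u = "map (apfst (\<lambda>a. n + a)) (word_of w)"
  have mono: "strict_mono_on A (\<lambda>a. n + a)" for A :: "nat set"
    by (simp add: strict_mono_on_def)
  show "word ?u"
    using word_word_of[of w] by (auto simp: word_def distinct_map inj_on_def)
  show "?u \<noteq> []"
    by (simp add: word_of_nonempty)
  show "\<langle>?u\<rangle> = basis_vec w"
    by (simp add: biword_vec_strict_mono mono biword_vec_word_of)
  show "n < a" if "a \<in> letters ?u" for a
  proof -
    have "perm w i \<ge> 1" if "i \<in> {1..len w}" for i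
      using that permutes_in_image[OF biword_props(2), of w i] by simp
    then show ?thesis
      using that by (auto simp: letters_def word_of_def image_iff simp del: upt_Suc) (meson One_nat_def Suc_le_eq atLeastAtMost_iff less_Suc_eq_le)
  qed
qed

lemma word_after:
  obtains v where "word v" "v \<noteq> []" "\<langle>v\<rangle> = basis_vec w" "below u v"
proof -
  obtain v where v: "word v" "v \<noteq> []" "\<langle>v\<rangle> = basis_vec w" "\<And>a. a \<in> letters v \<Longrightarrow> Max (letters u) < a"
    using word_above[of w "Max (letters u)"] by blast
  have "below u v"
    unfolding below_def
  proof (intro ballI)
    fix a b assume "a \<in> letters u" "b \<in> letters v"
    then show "a < b"
      using v(4) by (meson Max_ge le_less_trans letters_simps(4))
  qed
  with v(1-3) show thesis by (rule that)
qed

lemma bilinearQ_eq_on_words: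
  assumes "bilinearQ f" "bilinearQ g"
    and "\<And>u v. word u \<Longrightarrow> u \<noteq> [] \<Longrightarrow> word v \<Longrightarrow> v \<noteq> [] \<Longrightarrow> below u v \<Longrightarrow> f \<langle>u\<rangle> \<langle>v\<rangle> = g \<langle>u\<rangle> \<langle>v\<rangle>"
  shows "f x y = g x y"
proof (rule bilinearQ_eq_on_basis[OF assms(1,2)])
  fix b c
  obtain u where "word u" "u \<noteq> []" "\<langle>u\<rangle> = basis_vec b"
    using word_after[of b "[]"] by metis
  moreover obtain v where "word v" "v \<noteq> []" "\<langle>v\<rangle> = basis_vec c" "below u v"
    using word_after[of c u] by metis
  ultimately show "f (basis_vec b) (basis_vec c) = g (basis_vec b) (basis_vec c)"
    using assms(3) by metis
qed

lemma trilinear_eq_on_words: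
  fixes f g :: "Splus \<Rightarrow> Splus \<Rightarrow> Splus \<Rightarrow> 'v::rat_vector"
  assumes "\<And>y. bilinearQ (\<lambda>x. f x y)" "\<And>x z. linearQ (\<lambda>y. f x y z)"
    and "\<And>y. bilinearQ (\<lambda>x. g x y)" "\<And>x z. linearQ (\<lambda>y. g x y z)"
    and words: "\<And>u v w. word u \<Longrightarrow> u \<noteq> [] \<Longrightarrow> word v \<Longrightarrow> v \<noteq> [] \<Longrightarrow> word w \<Longrightarrow> w \<noteq> [] \<Longrightarrow>
      below u v \<Longrightarrow> below u w \<Longrightarrow> below v w \<Longrightarrow> f \<langle>u\<rangle> \<langle>v\<rangle> \<langle>w\<rangle> = g \<langle>u\<rangle> \<langle>v\<rangle> \<langle>w\<rangle>"
  shows "f x y z = g x y z"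
proof (rule linearQ_eq_on_basis[of "\<lambda>y. f x y z" "\<lambda>y. g x y z"])
  fix b
  show "f x (basis_vec b) z = g x (basis_vec b) z"
  proof (rule bilinearQ_eq_on_basis[of "\<lambda>x. f x (basis_vec b)" "\<lambda>x. g x (basis_vec b)"])
    fix a c
    obtain u where u: "word u" "u \<noteq> []" "\<langle>u\<rangle> = basis_vec a"
      using word_after[of a "[]"] by metis
    obtain v where v: "word v" "v \<noteq> []" "\<langle>v\<rangle> = basis_vec b" "below u v"
      using word_after[of b u] by metis
    obtain w where w: "word w" "w \<noteq> []" "\<langle>w\<rangle> = basis_vec c" "below (u @ v) w"
      using word_after[of c "u @ v"] by metis
    show "f (basis_vec a) (basis_vec b) (basis_vec c) = g (basis_vec a) (basis_vec b) (basis_vec c)"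
      using words[of u v w] u v w by (simp add: below_append)
  qed (rule assms)+
qed (rule assms)+


section \<open>Coproducts of products\<close>

text \<open>
  The smallest letter \<open>m\<close> of a shuffle is that of \<open>u\<close>, and no part of \<open>v\<close> contains it. So
  whether a left factor contains \<open>m\<close> depends on the cut of \<open>u\<close> only, and the condition can be
  pulled out of the inner sums.
\<close>
lemma coprod_shuffle:
  assumes "word u" "u \<noteq> []" "word v" "below u v"
  defines "m \<equiv> Min (letters u)"
  shows coprod_left_sum: "S_coprod b (left_sum biword_vec u v) = deconc_sum (\<lambda>u\<^sub>1 u\<^sub>2. deconc_sum (\<lambda>v\<^sub>1 v\<^sub>2.
      if (m \<in> letters u\<^sub>1) = b then left_sum biword_vec u\<^sub>1 v\<^sub>1 \<otimes> shuffle_sum biword_vec u\<^sub>2 v\<^sub>2 else 0) v) u"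
    and coprod_right_sum: "S_coprod b (right_sum biword_vec u v) = deconc_sum (\<lambda>u\<^sub>1 u\<^sub>2. deconc_sum (\<lambda>v\<^sub>1 v\<^sub>2.
      if (m \<in> letters u\<^sub>1) = b then right_sum biword_vec u\<^sub>1 v\<^sub>1 \<otimes> shuffle_sum biword_vec u\<^sub>2 v\<^sub>2 else 0) v) u"
proof -
  define G where "G = (\<lambda>p q. if (m \<in> letters p) = b then \<langle>p\<rangle> \<otimes> \<langle>q\<rangle> else 0)"
  have G0: "G [] q = 0" for q
    by (simp add: G_def tensor_zero)
  have m: "m \<in> letters u"
    using assms(2) by (simp add: m_def)
  have cop: "S_coprod b \<langle>z\<rangle> = deconc_sum G z" if "mset z = mset u + mset v" for z
    using that assms by (simp add: S_coprod_word word_shuffle Min_letters_shuffle G_def)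
  have G: "G p q = (if (m \<in> letters u\<^sub>1) = b then \<langle>p\<rangle> \<otimes> \<langle>q\<rangle> else 0)"
    if "v = v\<^sub>1 @ v\<^sub>2" "mset p = mset u\<^sub>1 + mset v\<^sub>1" for p q u\<^sub>1 v\<^sub>1 v\<^sub>2
  proof -
    have "m \<notin> letters v\<^sub>1"
      using m assms(4) that(1) by (auto simp: below_def)
    then show ?thesis
      by (simp add: G_def letters_mset[OF that(2)])
  qed
  have "S_coprod b (left_sum biword_vec u v) = left_sum (deconc_sum G) u v"
    unfolding left_sum_linear[OF linearQ_S_coprod] by (rule left_sum_cong) (rule cop)
  also have "\<dots> = deconc_sum (\<lambda>u\<^sub>1 u\<^sub>2. deconc_sum (\<lambda>v\<^sub>1 v\<^sub>2.
      left_sum (\<lambda>p. shuffle_sum (G p) u\<^sub>2 v\<^sub>2) u\<^sub>1 v\<^sub>1) v) u"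
    by (rule deconc_sum_left) (rule G0)
  also have "\<dots> = deconc_sum (\<lambda>u\<^sub>1 u\<^sub>2. deconc_sum (\<lambda>v\<^sub>1 v\<^sub>2.
      left_sum (\<lambda>p. shuffle_sum (\<lambda>q. if (m \<in> letters u\<^sub>1) = b then \<langle>p\<rangle> \<otimes> \<langle>q\<rangle> else 0) u\<^sub>2 v\<^sub>2) u\<^sub>1 v\<^sub>1) v) u"
    by (intro deconc_sum_cong left_sum_cong shuffle_sum_cong) (rule G)
  also have "\<dots> = deconc_sum (\<lambda>u\<^sub>1 u\<^sub>2. deconc_sum (\<lambda>v\<^sub>1 v\<^sub>2.
      if (m \<in> letters u\<^sub>1) = b then left_sum biword_vec u\<^sub>1 v\<^sub>1 \<otimes> shuffle_sum biword_vec u\<^sub>2 v\<^sub>2 else 0) v) u"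
    by (intro deconc_sum_cong) (simp add: left_sum_tensor)
  finally show "S_coprod b (left_sum biword_vec u v) = \<dots>" .
  have "S_coprod b (right_sum biword_vec u v) = right_sum (deconc_sum G) u v"
    unfolding right_sum_linear[OF linearQ_S_coprod] by (rule right_sum_cong) (rule cop)
  also have "\<dots> = deconc_sum (\<lambda>u\<^sub>1 u\<^sub>2. deconc_sum (\<lambda>v\<^sub>1 v\<^sub>2.
      right_sum (\<lambda>p. shuffle_sum (G p) u\<^sub>2 v\<^sub>2) u\<^sub>1 v\<^sub>1) v) u"
    by (rule deconc_sum_right) (rule G0)
  also have "\<dots> = deconc_sum (\<lambda>u\<^sub>1 u\<^sub>2. deconc_sum (\<lambda>v\<^sub>1 v\<^sub>2.
      right_sum (\<lambda>p. shuffle_sum (\<lambda>q. if (m \<in> letters u\<^sub>1) = b then \<langle>p\<rangle> \<otimes> \<langle>q\<rangle> else 0) u\<^sub>2 v\<^sub>2) u\<^sub>1 v\<^sub>1) v) u"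
    by (intro deconc_sum_cong right_sum_cong shuffle_sum_cong) (rule G)
  also have "\<dots> = deconc_sum (\<lambda>u\<^sub>1 u\<^sub>2. deconc_sum (\<lambda>v\<^sub>1 v\<^sub>2.
      if (m \<in> letters u\<^sub>1) = b then right_sum biword_vec u\<^sub>1 v\<^sub>1 \<otimes> shuffle_sum biword_vec u\<^sub>2 v\<^sub>2 else 0) v) u"
    by (intro deconc_sum_cong) (simp add: right_sum_tensor)
  finally show "S_coprod b (right_sum biword_vec u v) = \<dots>" .
qed

text \<open>
  The outer sum has the improper cuts of \<open>u\<close>, where the left factor contains \<open>m\<close> iff it is all of
  \<open>u\<close>, and the proper ones; each of them meets the two improper cuts of \<open>v\<close> and the proper ones.
  A left half product needs a nonempty left factor of \<open>u\<close>, a right one a nonempty left factor of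
  \<open>v\<close>, and the cut with both right factors empty gives \<open>0\<close>; the rest are the terms below.
\<close>
lemma
  assumes u: "word u" "u \<noteq> []" and v: "word v" "v \<noteq> []" and uv: "below u v"
  defines "m \<equiv> Min (letters u)"
  shows S_coprod_prec_word: "S_coprod b (\<langle>u\<rangle> \<prec> \<langle>v\<rangle>) =
      proper_sum (\<lambda>u\<^sub>1 u\<^sub>2. if (m \<in> letters u\<^sub>1) = b then
          proper_sum (\<lambda>v\<^sub>1 v\<^sub>2. (\<langle>u\<^sub>1\<rangle> \<prec> \<langle>v\<^sub>1\<rangle>) \<otimes> (\<langle>u\<^sub>2\<rangle> \<star> \<langle>v\<^sub>2\<rangle>)) v +
          \<langle>u\<^sub>1\<rangle> \<otimes> (\<langle>u\<^sub>2\<rangle> \<star> \<langle>v\<rangle>) + (\<langle>u\<^sub>1\<rangle> \<prec> \<langle>v\<rangle>) \<otimes> \<langle>u\<^sub>2\<rangle> else 0) u +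
      (if b then \<langle>u\<rangle> \<otimes> \<langle>v\<rangle> + proper_sum (\<lambda>v\<^sub>1 v\<^sub>2. (\<langle>u\<rangle> \<prec> \<langle>v\<^sub>1\<rangle>) \<otimes> \<langle>v\<^sub>2\<rangle>) v else 0)"
    and S_coprod_succ_word: "S_coprod b (\<langle>u\<rangle> \<succ> \<langle>v\<rangle>) =
      proper_sum (\<lambda>u\<^sub>1 u\<^sub>2. if (m \<in> letters u\<^sub>1) = b then
          proper_sum (\<lambda>v\<^sub>1 v\<^sub>2. (\<langle>u\<^sub>1\<rangle> \<succ> \<langle>v\<^sub>1\<rangle>) \<otimes> (\<langle>u\<^sub>2\<rangle> \<star> \<langle>v\<^sub>2\<rangle>)) v +
          (\<langle>u\<^sub>1\<rangle> \<succ> \<langle>v\<rangle>) \<otimes> \<langle>u\<^sub>2\<rangle> else 0) u +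
      (if b then proper_sum (\<lambda>v\<^sub>1 v\<^sub>2. (\<langle>u\<rangle> \<succ> \<langle>v\<^sub>1\<rangle>) \<otimes> \<langle>v\<^sub>2\<rangle>) v
       else \<langle>v\<rangle> \<otimes> \<langle>u\<rangle> + proper_sum (\<lambda>v\<^sub>1 v\<^sub>2. \<langle>v\<^sub>1\<rangle> \<otimes> (\<langle>u\<rangle> \<star> \<langle>v\<^sub>2\<rangle>)) v)"
proof -
  let ?l = "left_sum biword_vec" and ?r = "right_sum biword_vec" and ?s = "shuffle_sum biword_vec"
  have m: "m \<in> letters u"
    using u by (simp add: m_def)
  have "S_coprod b (\<langle>u\<rangle> \<prec> \<langle>v\<rangle>) = deconc_sum (\<lambda>u\<^sub>1 u\<^sub>2. deconc_sum (\<lambda>v\<^sub>1 v\<^sub>2.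
      if (m \<in> letters u\<^sub>1) = b then ?l u\<^sub>1 v\<^sub>1 \<otimes> ?s u\<^sub>2 v\<^sub>2 else 0) v) u"
    using u v uv by (simp add: S_prec_word coprod_left_sum m_def)
  also have "\<dots> = proper_sum (\<lambda>u\<^sub>1 u\<^sub>2. if (m \<in> letters u\<^sub>1) = b then
          proper_sum (\<lambda>v\<^sub>1 v\<^sub>2. ?l u\<^sub>1 v\<^sub>1 \<otimes> ?s u\<^sub>2 v\<^sub>2) v +
          ?l u\<^sub>1 [] \<otimes> ?s u\<^sub>2 v + ?l u\<^sub>1 v \<otimes> \<langle>u\<^sub>2\<rangle> else 0) u +
      (if b then \<langle>u\<rangle> \<otimes> \<langle>v\<rangle> + proper_sum (\<lambda>v\<^sub>1 v\<^sub>2. ?l u v\<^sub>1 \<otimes> \<langle>v\<^sub>2\<rangle>) v else 0)"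
    using m by (cases b) (simp_all add: deconc_sum_proper u v tensor_zero left_sum_Nil_right ac_simps
        if_distrib if_distribR cong: if_cong)
  also have "\<dots> = proper_sum (\<lambda>u\<^sub>1 u\<^sub>2. if (m \<in> letters u\<^sub>1) = b then
          proper_sum (\<lambda>v\<^sub>1 v\<^sub>2. (\<langle>u\<^sub>1\<rangle> \<prec> \<langle>v\<^sub>1\<rangle>) \<otimes> (\<langle>u\<^sub>2\<rangle> \<star> \<langle>v\<^sub>2\<rangle>)) v +
          \<langle>u\<^sub>1\<rangle> \<otimes> (\<langle>u\<^sub>2\<rangle> \<star> \<langle>v\<rangle>) + (\<langle>u\<^sub>1\<rangle> \<prec> \<langle>v\<rangle>) \<otimes> \<langle>u\<^sub>2\<rangle> else 0) u +
      (if b then \<langle>u\<rangle> \<otimes> \<langle>v\<rangle> + proper_sum (\<lambda>v\<^sub>1 v\<^sub>2. (\<langle>u\<rangle> \<prec> \<langle>v\<^sub>1\<rangle>) \<otimes> \<langle>v\<^sub>2\<rangle>) v else 0)"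
    using u v uv
    by (intro refl arg_cong2[of _ _ _ _ "(+)"] arg_cong2[of _ _ _ _ tensor] if_cong proper_sum_cong)
      (auto simp: S_prec_word S_star_word word_append below_append left_sum_Nil_right)
  finally show "S_coprod b (\<langle>u\<rangle> \<prec> \<langle>v\<rangle>) = \<dots>" .
  have "S_coprod b (\<langle>u\<rangle> \<succ> \<langle>v\<rangle>) = deconc_sum (\<lambda>u\<^sub>1 u\<^sub>2. deconc_sum (\<lambda>v\<^sub>1 v\<^sub>2.
      if (m \<in> letters u\<^sub>1) = b then ?r u\<^sub>1 v\<^sub>1 \<otimes> ?s u\<^sub>2 v\<^sub>2 else 0) v) u"
    using u v uv by (simp add: S_succ_word coprod_right_sum m_def)
  also have "\<dots> = proper_sum (\<lambda>u\<^sub>1 u\<^sub>2. if (m \<in> letters u\<^sub>1) = b then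
          proper_sum (\<lambda>v\<^sub>1 v\<^sub>2. ?r u\<^sub>1 v\<^sub>1 \<otimes> ?s u\<^sub>2 v\<^sub>2) v + ?r u\<^sub>1 v \<otimes> \<langle>u\<^sub>2\<rangle> else 0) u +
      (if b then proper_sum (\<lambda>v\<^sub>1 v\<^sub>2. ?r u v\<^sub>1 \<otimes> \<langle>v\<^sub>2\<rangle>) v
       else \<langle>v\<rangle> \<otimes> \<langle>u\<rangle> + proper_sum (\<lambda>v\<^sub>1 v\<^sub>2. ?r [] v\<^sub>1 \<otimes> ?s u v\<^sub>2) v)"
    using m by (cases b) (simp_all add: deconc_sum_proper u v tensor_zero right_sum_Nil_left ac_simps
        if_distrib if_distribR cong: if_cong)
  also have "\<dots> = proper_sum (\<lambda>u\<^sub>1 u\<^sub>2. if (m \<in> letters u\<^sub>1) = b then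
          proper_sum (\<lambda>v\<^sub>1 v\<^sub>2. (\<langle>u\<^sub>1\<rangle> \<succ> \<langle>v\<^sub>1\<rangle>) \<otimes> (\<langle>u\<^sub>2\<rangle> \<star> \<langle>v\<^sub>2\<rangle>)) v +
          (\<langle>u\<^sub>1\<rangle> \<succ> \<langle>v\<rangle>) \<otimes> \<langle>u\<^sub>2\<rangle> else 0) u +
      (if b then proper_sum (\<lambda>v\<^sub>1 v\<^sub>2. (\<langle>u\<rangle> \<succ> \<langle>v\<^sub>1\<rangle>) \<otimes> \<langle>v\<^sub>2\<rangle>) v
       else \<langle>v\<rangle> \<otimes> \<langle>u\<rangle> + proper_sum (\<lambda>v\<^sub>1 v\<^sub>2. \<langle>v\<^sub>1\<rangle> \<otimes> (\<langle>u\<rangle> \<star> \<langle>v\<^sub>2\<rangle>)) v)"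
    using u v uv
    by (intro refl arg_cong2[of _ _ _ _ "(+)"] arg_cong2[of _ _ _ _ tensor] if_cong proper_sum_cong)
      (auto simp: S_succ_word S_star_word word_append below_append right_sum_Nil_left)
  finally show "S_coprod b (\<langle>u\<rangle> \<succ> \<langle>v\<rangle>) = \<dots>" .
qed

lemmas lift_bilinear = bilinearQ_iff linearQ_iff tensor_lift_left_add tensor_lift_left_scale
  tensor_lift_add tensor_lift_scale tensor_lift_fun_add
  tensor_lift_fun_scale tensor_bilinear product_bilinear S_coprod_add S_coprod_scale
  S_ctotal_add S_ctotal_scale scaleQ_add_right scaleQ_scaleQ

lemma bilinearQ_proper_sum:
  fixes f g :: "Splus \<Rightarrow> Splus \<Rightarrow> Splus"
  assumes "bilinearQ f" "bilinearQ g"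
  shows "bilinearQ (\<lambda>x' x''. proper_sum (\<lambda>p q. f x' \<langle>p\<rangle> \<otimes> g x'' \<langle>q\<rangle>) z)"
  using bilinearQ_tensor_slots(2)[OF assms] unfolding bilinearQ_iff proper_sum_def
  by (simp add: sum.distrib rat_vector.scale_sum_right)

lemma tensor_lift_proper_sum:
  assumes "bilinearQ f"
  shows "tensor_lift f (proper_sum (\<lambda>p q. if P p then g p \<otimes> h q else 0) z) =
      proper_sum (\<lambda>p q. if P p then f (g p) (h q) else 0) z"
    and "tensor_lift f (proper_sum (\<lambda>p q. g p \<otimes> h q) z) = proper_sum (\<lambda>p q. f (g p) (h q)) z"
  using assms
  by (auto simp: proper_sum_linear[OF linearQ_tensor_lift] tensor_lift_tensor tensor_lift_zero
      intro!: proper_sum_cong)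

lemma S_coprod_prec:
  "S_coprod b (x \<prec> y) =
      tensor_lift (\<lambda>x' x''. tensor_lift (\<lambda>y' y''. (x' \<prec> y') \<otimes> (x'' \<star> y'')) (\<Delta> y)) (S_coprod b x)
    + tensor_lift (\<lambda>x' x''. x' \<otimes> (x'' \<star> y)) (S_coprod b x)
    + tensor_lift (\<lambda>x' x''. (x' \<prec> y) \<otimes> x'') (S_coprod b x)
    + (if b then x \<otimes> y + tensor_lift (\<lambda>y' y''. (x \<prec> y') \<otimes> y'') (\<Delta> y) else 0)"
  (is "_ = ?rhs x y")
proof (rule bilinearQ_eq_on_words[of "\<lambda>x y. S_coprod b (x \<prec> y)" ?rhs])
  show "bilinearQ (\<lambda>x y. S_coprod b (x \<prec> y))"
    by (simp add: lift_bilinear)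
  show "bilinearQ ?rhs"
    by (simp add: lift_bilinear ac_simps)
next
  fix u v assume "word u" "u \<noteq> []" "word v" "v \<noteq> []" "below u v"
  then show "S_coprod b (\<langle>u\<rangle> \<prec> \<langle>v\<rangle>) = ?rhs \<langle>u\<rangle> \<langle>v\<rangle>"
    by (simp add: S_coprod_prec_word)
      (simp add: S_coprod_proper S_ctotal_proper tensor_lift_proper_sum product_slots
        bilinearQ_proper_sum[OF bilinearQ_S_prec bilinearQ_S_star]
        proper_sum_add[symmetric] if_distrib ac_simps cong: if_cong)
qed

lemma S_coprod_succ:
  "S_coprod b (x \<succ> y) =
      tensor_lift (\<lambda>x' x''. tensor_lift (\<lambda>y' y''. (x' \<succ> y') \<otimes> (x'' \<star> y'')) (\<Delta> y)) (S_coprod b x)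
    + tensor_lift (\<lambda>x' x''. (x' \<succ> y) \<otimes> x'') (S_coprod b x)
    + (if b then tensor_lift (\<lambda>y' y''. (x \<succ> y') \<otimes> y'') (\<Delta> y)
       else y \<otimes> x + tensor_lift (\<lambda>y' y''. y' \<otimes> (x \<star> y'')) (\<Delta> y))"
  (is "_ = ?rhs x y")
proof (rule bilinearQ_eq_on_words[of "\<lambda>x y. S_coprod b (x \<succ> y)" ?rhs])
  show "bilinearQ (\<lambda>x y. S_coprod b (x \<succ> y))"
    by (simp add: lift_bilinear)
  show "bilinearQ ?rhs"
    by (simp add: lift_bilinear ac_simps)
next
  fix u v assume "word u" "u \<noteq> []" "word v" "v \<noteq> []" "below u v"
  then show "S_coprod b (\<langle>u\<rangle> \<succ> \<langle>v\<rangle>) = ?rhs \<langle>u\<rangle> \<langle>v\<rangle>"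
    by (simp add: S_coprod_succ_word)
      (simp add: S_coprod_proper S_ctotal_proper tensor_lift_proper_sum product_slots
        bilinearQ_proper_sum[OF bilinearQ_S_succ bilinearQ_S_star]
        proper_sum_add[symmetric] if_distrib ac_simps cong: if_cong)
qed


section \<open>Dendriform axioms\<close>

text \<open>
  The representatives lie below one another, hence so does any shuffle of two of them with
  respect to the third, and every product is a sum over shuffles.
\<close>
lemma
  assumes "word u" "u \<noteq> []" "word v" "v \<noteq> []" "word w" "w \<noteq> []" "below u v" "below u w" "below v w"
  shows prec_prec_words: "(\<langle>u\<rangle> \<prec> \<langle>v\<rangle>) \<prec> \<langle>w\<rangle> = \<langle>u\<rangle> \<prec> (\<langle>v\<rangle> \<star> \<langle>w\<rangle>)"
    and succ_prec_words: "(\<langle>u\<rangle> \<succ> \<langle>v\<rangle>) \<prec> \<langle>w\<rangle> = \<langle>u\<rangle> \<succ> (\<langle>v\<rangle> \<prec> \<langle>w\<rangle>)"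
    and star_succ_words: "(\<langle>u\<rangle> \<star> \<langle>v\<rangle>) \<succ> \<langle>w\<rangle> = \<langle>u\<rangle> \<succ> (\<langle>v\<rangle> \<succ> \<langle>w\<rangle>)"
proof -
  have lin: "linearQ (\<lambda>x. x \<prec> y)" "linearQ (\<lambda>x. x \<succ> y)" "linearQ (\<lambda>x. y \<prec> x)" "linearQ (\<lambda>x. y \<succ> x)" for y
    using bilinearQ_S_prec bilinearQ_S_succ by (simp_all add: bilinearQ_def)
  have left: "\<langle>z\<rangle> \<prec> \<langle>w\<rangle> = left_sum biword_vec z w" "\<langle>z\<rangle> \<succ> \<langle>w\<rangle> = right_sum biword_vec z w"
    if "mset z = mset u + mset v" for z
    using assms word_shuffle[OF that] below_shuffle(1)[OF that] shuffle_nonempty[OF that]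
    by (simp_all add: S_prec_word S_succ_word)
  have right: "\<langle>u\<rangle> \<prec> \<langle>z\<rangle> = left_sum biword_vec u z" "\<langle>u\<rangle> \<succ> \<langle>z\<rangle> = right_sum biword_vec u z"
    if "mset z = mset v + mset w" for z
    using assms word_shuffle[OF that] below_shuffle(2)[OF that] shuffle_nonempty[OF that]
    by (simp_all add: S_prec_word S_succ_word)
  have uv: "\<langle>u\<rangle> \<prec> \<langle>v\<rangle> = left_sum biword_vec u v" "\<langle>u\<rangle> \<succ> \<langle>v\<rangle> = right_sum biword_vec u v"
    "\<langle>u\<rangle> \<star> \<langle>v\<rangle> = shuffle_sum biword_vec u v"
    using assms by (simp_all add: S_prec_word S_succ_word S_star_word)
  have vw: "\<langle>v\<rangle> \<prec> \<langle>w\<rangle> = left_sum biword_vec v w" "\<langle>v\<rangle> \<succ> \<langle>w\<rangle> = right_sum biword_vec v w"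
    "\<langle>v\<rangle> \<star> \<langle>w\<rangle> = shuffle_sum biword_vec v w"
    using assms by (simp_all add: S_prec_word S_succ_word S_star_word)
  note push = left_sum_linear[OF lin(1)] left_sum_linear[OF lin(2)] left_sum_linear[OF lin(3)]
    left_sum_linear[OF lin(4)] right_sum_linear[OF lin(1)] right_sum_linear[OF lin(2)]
    right_sum_linear[OF lin(3)] right_sum_linear[OF lin(4)] shuffle_sum_linear[OF lin(1)]
    shuffle_sum_linear[OF lin(2)] shuffle_sum_linear[OF lin(3)] shuffle_sum_linear[OF lin(4)]
  note cong = left_sum_cong[OF left(1)] left_sum_cong[OF left(2)] right_sum_cong[OF left(1)]
    shuffle_sum_cong[OF left(2)] shuffle_sum_cong[OF right(1)] left_sum_cong[OF right(2)]
    right_sum_cong[OF right(2)]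
  show "(\<langle>u\<rangle> \<prec> \<langle>v\<rangle>) \<prec> \<langle>w\<rangle> = \<langle>u\<rangle> \<prec> (\<langle>v\<rangle> \<star> \<langle>w\<rangle>)"
    and "(\<langle>u\<rangle> \<succ> \<langle>v\<rangle>) \<prec> \<langle>w\<rangle> = \<langle>u\<rangle> \<succ> (\<langle>v\<rangle> \<prec> \<langle>w\<rangle>)"
    and "(\<langle>u\<rangle> \<star> \<langle>v\<rangle>) \<succ> \<langle>w\<rangle> = \<langle>u\<rangle> \<succ> (\<langle>v\<rangle> \<succ> \<langle>w\<rangle>)"
    unfolding uv vw push by (simp_all only: cong left_left_sum right_left_sum right_right_sum)
qed

lemma
  shows S_prec_prec: "(x \<prec> y) \<prec> z = x \<prec> (y \<star> z)"
    and S_succ_prec: "(x \<succ> y) \<prec> z = x \<succ> (y \<prec> z)"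
    and S_star_succ: "(x \<star> y) \<succ> z = x \<succ> (y \<succ> z)"
  by (rule trilinear_eq_on_words; simp add: bilinearQ_iff linearQ_iff product_bilinear
      prec_prec_words succ_prec_words star_succ_words)+


section \<open>The opposite coproducts\<close>

text \<open>
  The truth value keeps its meaning for the word before the flip: \<open>op_coprod True\<close> is the opposite
  of \<open>\<Delta>\<^sub>\<prec>\<close>, which is the second coproduct of the opposite structure.
\<close>
definition op_coprod :: "bool \<Rightarrow> Splus \<Rightarrow> Splus \<otimes> Splus"
  where "op_coprod b x = tensor_flip (S_coprod b x)"

lemma linearQ_op_coprod: "linearQ (op_coprod b)"
  unfolding op_coprod_def[abs_def] by (rule linearQ_comp[OF linearQ_flip linearQ_S_coprod])

lemma linearQ_op_ctotal: "linearQ (\<lambda>x. op_coprod b x + op_coprod c x)"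
  using linearQ_op_coprod[of b] linearQ_op_coprod[of c]
  by (simp add: linearQ_iff scaleQ_add_right algebra_simps)

lemma op_coprod_word:
  assumes "word z"
  shows "op_coprod b \<langle>z\<rangle> =
    deconc_sum (\<lambda>p q. if (Min (letters z) \<in> letters p) = b then \<langle>q\<rangle> \<otimes> \<langle>p\<rangle> else 0) z"
  unfolding op_coprod_def S_coprod_word[OF assms] deconc_sum_linear[OF linearQ_flip]
  by (rule deconc_sum_cong) (simp add: tensor_flip_tensor linearQ_zero[OF linearQ_flip])

lemma op_ctotal_word:
  assumes "word z"
  shows "op_coprod b \<langle>z\<rangle> + op_coprod (\<not> b) \<langle>z\<rangle> = deconc_sum (\<lambda>p q. \<langle>q\<rangle> \<otimes> \<langle>p\<rangle>) z"
  unfolding op_coprod_word[OF assms] deconc_sum_add[symmetric]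
  by (rule deconc_sum_cong) simp

text \<open>
  The condition \<open>P\<close> is that of \<open>op_coprod c\<close> or the true one of the total coproduct, so that one
  computation serves all left-hand sides of the coalgebra axioms.
\<close>
lemma op_coassoc_left:
  assumes z: "word z" and f: "linearQ f"
    and f_word: "\<And>q. word q \<Longrightarrow> f \<langle>q\<rangle> =
      deconc_sum (\<lambda>q\<^sub>1 q\<^sub>2. if P q q\<^sub>1 then \<langle>q\<^sub>2\<rangle> \<otimes> \<langle>q\<^sub>1\<rangle> else 0) q"
  shows "tensor_assoc (tensor_map f id (op_coprod b \<langle>z\<rangle>)) =
    deconc_sum (\<lambda>p q. deconc_sum (\<lambda>q\<^sub>1 q\<^sub>2. if (Min (letters z) \<in> letters p) = b \<and> P q q\<^sub>1
      then \<langle>q\<^sub>2\<rangle> \<otimes> (\<langle>q\<^sub>1\<rangle> \<otimes> \<langle>p\<rangle>) else 0) q) z"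
proof -
  have id: "linearQ (id :: Splus \<Rightarrow> Splus)"
    by (simp add: linearQ_iff)
  have h: "linearQ (\<lambda>t :: Splus \<otimes> Splus. tensor_assoc (tensor_map f id t))"
    by (rule linearQ_comp[OF linearQ_assoc linearQ_map[OF f id]])
  have l: "linearQ (\<lambda>s. tensor_assoc (s \<otimes> c))" for c :: Splus
    by (rule linearQ_comp[OF linearQ_assoc]) (simp add: linearQ_iff tensor_bilinear)
  show ?thesis
    unfolding op_coprod_word[OF z] deconc_sum_linear[OF h]
  proof (rule deconc_sum_cong)
    fix p q assume "z = p @ q"
    then have "word q"
      using z by (simp add: word_append)
    have "tensor_assoc (tensor_map f id (\<langle>q\<rangle> \<otimes> \<langle>p\<rangle>)) = tensor_assoc (f \<langle>q\<rangle> \<otimes> \<langle>p\<rangle>)"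
      by (simp add: tensor_map_tensor f id)
    also have "\<dots> = deconc_sum (\<lambda>q\<^sub>1 q\<^sub>2. if P q q\<^sub>1 then \<langle>q\<^sub>2\<rangle> \<otimes> (\<langle>q\<^sub>1\<rangle> \<otimes> \<langle>p\<rangle>) else 0) q"
      unfolding f_word[OF \<open>word q\<close>] deconc_sum_linear[OF l]
      by (rule deconc_sum_cong) (simp add: tensor_assoc_tensor tensor_zero linearQ_zero[OF linearQ_assoc])
    finally show "tensor_assoc (tensor_map f id (if (Min (letters z) \<in> letters p) = b then \<langle>q\<rangle> \<otimes> \<langle>p\<rangle> else 0)) =
        deconc_sum (\<lambda>q\<^sub>1 q\<^sub>2. if (Min (letters z) \<in> letters p) = b \<and> P q q\<^sub>1
          then \<langle>q\<^sub>2\<rangle> \<otimes> (\<langle>q\<^sub>1\<rangle> \<otimes> \<langle>p\<rangle>) else 0) q"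
      using linearQ_zero[OF h] by simp
  qed
qed

text \<open>
  The counterpart for the right-hand sides. The double cuts of the left factor are regrouped by
  coassociativity of cutting, so that the two sides can be compared summand by summand.
\<close>
lemma op_coassoc_right:
  assumes z: "word z" and f: "linearQ f"
    and f_word: "\<And>p. word p \<Longrightarrow> f \<langle>p\<rangle> =
      deconc_sum (\<lambda>p\<^sub>1 p\<^sub>2. if P p p\<^sub>1 then \<langle>p\<^sub>2\<rangle> \<otimes> \<langle>p\<^sub>1\<rangle> else 0) p"
  shows "tensor_map id f (op_coprod b \<langle>z\<rangle>) =
    deconc_sum (\<lambda>p q. deconc_sum (\<lambda>q\<^sub>1 q\<^sub>2. if (Min (letters z) \<in> letters (p @ q\<^sub>1)) = b \<and> P (p @ q\<^sub>1) p
      then \<langle>q\<^sub>2\<rangle> \<otimes> (\<langle>q\<^sub>1\<rangle> \<otimes> \<langle>p\<rangle>) else 0) q) z"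
proof -
  have id: "linearQ (id :: Splus \<Rightarrow> Splus)"
    by (simp add: linearQ_iff)
  note h = linearQ_map[OF id f]
  have l: "linearQ (\<lambda>s. c \<otimes> s)" for c :: Splus and s :: "Splus \<otimes> Splus"
    by (simp add: linearQ_iff tensor_bilinear)
  have "tensor_map id f (op_coprod b \<langle>z\<rangle>) =
    deconc_sum (\<lambda>p q. deconc_sum (\<lambda>p\<^sub>1 p\<^sub>2. if (Min (letters z) \<in> letters (p\<^sub>1 @ p\<^sub>2)) = b \<and> P (p\<^sub>1 @ p\<^sub>2) p\<^sub>1
      then \<langle>q\<rangle> \<otimes> (\<langle>p\<^sub>2\<rangle> \<otimes> \<langle>p\<^sub>1\<rangle>) else 0) p) z"
    unfolding op_coprod_word[OF z] deconc_sum_linear[OF h]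
  proof (rule deconc_sum_cong)
    fix p q assume "z = p @ q"
    then have "word p"
      using z by (simp add: word_append)
    have "tensor_map id f (\<langle>q\<rangle> \<otimes> \<langle>p\<rangle>) = \<langle>q\<rangle> \<otimes> f \<langle>p\<rangle>"
      by (simp add: tensor_map_tensor f id)
    also have "\<dots> = deconc_sum (\<lambda>p\<^sub>1 p\<^sub>2. if P p p\<^sub>1 then \<langle>q\<rangle> \<otimes> (\<langle>p\<^sub>2\<rangle> \<otimes> \<langle>p\<^sub>1\<rangle>) else 0) p"
      unfolding f_word[OF \<open>word p\<close>] deconc_sum_linear[OF l]
      by (rule deconc_sum_cong) (simp add: tensor_zero)
    also have "\<dots> = deconc_sum (\<lambda>p\<^sub>1 p\<^sub>2. if P (p\<^sub>1 @ p\<^sub>2) p\<^sub>1 then \<langle>q\<rangle> \<otimes> (\<langle>p\<^sub>2\<rangle> \<otimes> \<langle>p\<^sub>1\<rangle>) else 0) p"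
      by (rule deconc_sum_cong) simp
    finally have *: "tensor_map id f (\<langle>q\<rangle> \<otimes> \<langle>p\<rangle>) = \<dots>" .
    have "tensor_map id f (if (Min (letters z) \<in> letters p) = b then \<langle>q\<rangle> \<otimes> \<langle>p\<rangle> else 0) =
        deconc_sum (\<lambda>p\<^sub>1 p\<^sub>2. if (Min (letters z) \<in> letters p) = b \<and> P (p\<^sub>1 @ p\<^sub>2) p\<^sub>1
          then \<langle>q\<rangle> \<otimes> (\<langle>p\<^sub>2\<rangle> \<otimes> \<langle>p\<^sub>1\<rangle>) else 0) p"
      using * linearQ_zero[OF h] by simp
    also have "\<dots> = deconc_sum (\<lambda>p\<^sub>1 p\<^sub>2. if (Min (letters z) \<in> letters (p\<^sub>1 @ p\<^sub>2)) = b \<and> P (p\<^sub>1 @ p\<^sub>2) p\<^sub>1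
          then \<langle>q\<rangle> \<otimes> (\<langle>p\<^sub>2\<rangle> \<otimes> \<langle>p\<^sub>1\<rangle>) else 0) p"
      by (rule deconc_sum_cong) simp
    finally show "tensor_map id f (if (Min (letters z) \<in> letters p) = b then \<langle>q\<rangle> \<otimes> \<langle>p\<rangle> else 0) = \<dots>" .
  qed
  then show ?thesis
    unfolding deconc_sum_coassoc[where T = "\<lambda>p\<^sub>1 p\<^sub>2 q. if (Min (letters z) \<in> letters (p\<^sub>1 @ p\<^sub>2)) = b \<and>
      P (p\<^sub>1 @ p\<^sub>2) p\<^sub>1 then \<langle>q\<rangle> \<otimes> (\<langle>p\<^sub>2\<rangle> \<otimes> \<langle>p\<^sub>1\<rangle>) else 0"] .
qed

lemma Min_letters_factor:
  assumes "Min (letters (p @ q @ r)) \<in> letters q"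
  shows "Min (letters q) = Min (letters (p @ q @ r))"
  by (rule Min_eqI) (use assms in auto)

text \<open>
  Each axiom compares two conditions on words that are cut into three parts \<open>p\<close>, \<open>q\<^sub>1\<close>, \<open>q\<^sub>2\<close>. Both
  say that the smallest letter lies in \<open>q\<^sub>2\<close>, in \<open>q\<^sub>1\<close> and in \<open>p\<close>, respectively.
\<close>
lemma
  shows op_coassoc_total_right: "tensor_assoc (tensor_map (op_coprod False) id (op_coprod False x)) =
      tensor_map id (\<lambda>x. op_coprod False x + op_coprod True x) (op_coprod False x)"
    and op_coassoc_mixed: "tensor_assoc (tensor_map (op_coprod True) id (op_coprod False x)) =
      tensor_map id (op_coprod False) (op_coprod True x)"
    and op_coassoc_total_left: "tensor_assoc (tensor_map (\<lambda>x. op_coprod False x + op_coprod True x) id (op_coprod True x)) =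
      tensor_map id (op_coprod True) (op_coprod True x)"
proof -
  have id: "linearQ (id :: Splus \<Rightarrow> Splus)"
    by (simp add: linearQ_iff)
  have lin: "linearQ (\<lambda>x. tensor_assoc (tensor_map f id (op_coprod b x)))"
    "linearQ (\<lambda>x. tensor_map id f (op_coprod b x))"
    if "linearQ f" for f :: "Splus \<Rightarrow> Splus \<otimes> Splus" and b
    by (rule linearQ_comp[OF linearQ_assoc linearQ_comp[OF linearQ_map[OF that id] linearQ_op_coprod]],
        rule linearQ_comp[OF linearQ_map[OF id that] linearQ_op_coprod])
  have Min_suffix: "Min (letters q) = Min (letters z)"
    if "z = p @ q" "Min (letters z) \<in> letters q" for z p q
    using Min_letters_factor[of p q "[]"] that by simp
  have Min_prefix: "Min (letters q) = Min (letters z)"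
    if "z = q @ r" "Min (letters z) \<in> letters q" for z q r
    using Min_letters_factor[of "[]" q r] that by simp
  have total: "op_coprod False \<langle>z\<rangle> + op_coprod True \<langle>z\<rangle> =
      deconc_sum (\<lambda>p q. if True then \<langle>q\<rangle> \<otimes> \<langle>p\<rangle> else 0) z" if "word z" for z
    using op_ctotal_word[OF that, of False] by simp
  have basis: "f x = g x" if "linearQ f" "linearQ g" "\<And>z. word z \<Longrightarrow> z \<noteq> [] \<Longrightarrow> f \<langle>z\<rangle> = g \<langle>z\<rangle>"
    for f g :: "Splus \<Rightarrow> Splus \<otimes> Splus \<otimes> Splus"
    by (rule linearQ_eq_on_basis[OF that(1,2)])
      (use that(3)[OF word_word_of word_of_nonempty] in \<open>simp add: biword_vec_word_of\<close>)
  have mem: "Min (letters z) \<in> letters p \<or> Min (letters z) \<in> letters q" if "z \<noteq> []" "z = p @ q" for z p q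
    using that Min_in[of "letters z"] by simp
  define m where "m z = Min (letters z)" for z
  have cond:
    "(m z \<notin> letters p \<and> m q \<notin> letters q\<^sub>1) = (m z \<notin> letters (p @ q\<^sub>1))"
    "(m z \<notin> letters p \<and> m q \<in> letters q\<^sub>1) = (m z \<in> letters (p @ q\<^sub>1) \<and> m (p @ q\<^sub>1) \<notin> letters p)"
    "(m z \<in> letters p) = (m z \<in> letters (p @ q\<^sub>1) \<and> m (p @ q\<^sub>1) \<in> letters p)"
    if "z \<noteq> []" "z = p @ q" "q = q\<^sub>1 @ q\<^sub>2" for z p q q\<^sub>1 q\<^sub>2
  proof -
    have "m z \<in> letters p \<or> m z \<in> letters q"
      using mem[OF that(1,2)] by (simp add: m_def)
    moreover have "m z \<in> letters q \<Longrightarrow> m q = m z"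
      using Min_suffix[OF that(2)] by (simp add: m_def)
    moreover have "m z \<in> letters (p @ q\<^sub>1) \<Longrightarrow> m (p @ q\<^sub>1) = m z"
      unfolding m_def by (rule Min_prefix[of z "p @ q\<^sub>1" q\<^sub>2]) (simp_all add: that)
    ultimately show
      "(m z \<notin> letters p \<and> m q \<notin> letters q\<^sub>1) = (m z \<notin> letters (p @ q\<^sub>1))"
      "(m z \<notin> letters p \<and> m q \<in> letters q\<^sub>1) = (m z \<in> letters (p @ q\<^sub>1) \<and> m (p @ q\<^sub>1) \<notin> letters p)"
      "(m z \<in> letters p) = (m z \<in> letters (p @ q\<^sub>1) \<and> m (p @ q\<^sub>1) \<in> letters p)"
      by auto
  qed
  have left: "tensor_assoc (tensor_map (op_coprod c) id (op_coprod b \<langle>z\<rangle>)) =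
      deconc_sum (\<lambda>p q. deconc_sum (\<lambda>q\<^sub>1 q\<^sub>2. if (m z \<in> letters p) = b \<and> (m q \<in> letters q\<^sub>1) = c
        then \<langle>q\<^sub>2\<rangle> \<otimes> (\<langle>q\<^sub>1\<rangle> \<otimes> \<langle>p\<rangle>) else 0) q) z" if "word z" for b c z
    unfolding m_def by (intro op_coassoc_left that linearQ_op_coprod op_coprod_word)
  have right: "tensor_map id (op_coprod c) (op_coprod b \<langle>z\<rangle>) =
      deconc_sum (\<lambda>p q. deconc_sum (\<lambda>q\<^sub>1 q\<^sub>2. if (m z \<in> letters (p @ q\<^sub>1)) = b \<and> (m (p @ q\<^sub>1) \<in> letters p) = c
        then \<langle>q\<^sub>2\<rangle> \<otimes> (\<langle>q\<^sub>1\<rangle> \<otimes> \<langle>p\<rangle>) else 0) q) z" if "word z" for b c z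
    unfolding m_def by (rule op_coassoc_right[OF that linearQ_op_coprod op_coprod_word])
  have total_left: "tensor_assoc (tensor_map (\<lambda>x. op_coprod False x + op_coprod True x) id (op_coprod b \<langle>z\<rangle>)) =
      deconc_sum (\<lambda>p q. deconc_sum (\<lambda>q\<^sub>1 q\<^sub>2. if (m z \<in> letters p) = b \<and> True
        then \<langle>q\<^sub>2\<rangle> \<otimes> (\<langle>q\<^sub>1\<rangle> \<otimes> \<langle>p\<rangle>) else 0) q) z" if "word z" for b z
    unfolding m_def by (rule op_coassoc_left[OF that linearQ_op_ctotal total])
  have total_right: "tensor_map id (\<lambda>x. op_coprod False x + op_coprod True x) (op_coprod b \<langle>z\<rangle>) =
      deconc_sum (\<lambda>p q. deconc_sum (\<lambda>q\<^sub>1 q\<^sub>2. if (m z \<in> letters (p @ q\<^sub>1)) = b \<and> True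
        then \<langle>q\<^sub>2\<rangle> \<otimes> (\<langle>q\<^sub>1\<rangle> \<otimes> \<langle>p\<rangle>) else 0) q) z" if "word z" for b z
    unfolding m_def by (rule op_coassoc_right[OF that linearQ_op_ctotal total])
  show "tensor_assoc (tensor_map (op_coprod False) id (op_coprod False x)) =
      tensor_map id (\<lambda>x. op_coprod False x + op_coprod True x) (op_coprod False x)"
  proof (rule basis[OF lin(1)[OF linearQ_op_coprod] lin(2)[OF linearQ_op_ctotal]])
    fix z assume z: "word z" "z \<noteq> []"
    show "tensor_assoc (tensor_map (op_coprod False) id (op_coprod False \<langle>z\<rangle>)) =
      tensor_map id (\<lambda>x. op_coprod False x + op_coprod True x) (op_coprod False \<langle>z\<rangle>)"
      unfolding left[OF z(1)] total_right[OF z(1)]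
      by (intro deconc_sum_cong if_cong refl) (use cond(1)[OF z(2)] in simp)
  qed
  show "tensor_assoc (tensor_map (op_coprod True) id (op_coprod False x)) =
      tensor_map id (op_coprod False) (op_coprod True x)"
  proof (rule basis[OF lin(1)[OF linearQ_op_coprod] lin(2)[OF linearQ_op_coprod]])
    fix z assume z: "word z" "z \<noteq> []"
    show "tensor_assoc (tensor_map (op_coprod True) id (op_coprod False \<langle>z\<rangle>)) =
      tensor_map id (op_coprod False) (op_coprod True \<langle>z\<rangle>)"
      unfolding left[OF z(1)] right[OF z(1)]
      by (intro deconc_sum_cong if_cong refl) (use cond(2)[OF z(2)] in simp)
  qed
  show "tensor_assoc (tensor_map (\<lambda>x. op_coprod False x + op_coprod True x) id (op_coprod True x)) =
      tensor_map id (op_coprod True) (op_coprod True x)"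
  proof (rule basis[OF lin(1)[OF linearQ_op_ctotal] lin(2)[OF linearQ_op_coprod]])
    fix z assume z: "word z" "z \<noteq> []"
    show "tensor_assoc (tensor_map (\<lambda>x. op_coprod False x + op_coprod True x) id (op_coprod True \<langle>z\<rangle>)) =
      tensor_map id (op_coprod True) (op_coprod True \<langle>z\<rangle>)"
      unfolding total_left[OF z(1)] right[OF z(1)]
      by (intro deconc_sum_cong if_cong refl) (use cond(3)[OF z(2)] in simp)
  qed
qed

lemma flip_S_ctotal: "tensor_flip (\<Delta> x) = op_coprod False x + op_coprod True x"
  by (simp add: S_ctotal_def op_coprod_def S_coprod_def tensor_flip_add)

lemma
  shows op_coprod_prec: "op_coprod b (x \<prec> y) =
      tensor_lift (\<lambda>y' y''. tensor_lift (\<lambda>x' x''. (x' \<star> y') \<otimes> (x'' \<prec> y'')) (op_coprod b x))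
        (op_coprod False y + op_coprod True y)
    + tensor_lift (\<lambda>x' x''. (x' \<star> y) \<otimes> x'') (op_coprod b x)
    + tensor_lift (\<lambda>x' x''. x' \<otimes> (x'' \<prec> y)) (op_coprod b x)
    + (if b then y \<otimes> x + tensor_lift (\<lambda>y' y''. y' \<otimes> (x \<prec> y'')) (op_coprod False y + op_coprod True y) else 0)"
    and op_coprod_succ: "op_coprod b (x \<succ> y) =
      tensor_lift (\<lambda>y' y''. tensor_lift (\<lambda>x' x''. (x' \<star> y') \<otimes> (x'' \<succ> y'')) (op_coprod b x))
        (op_coprod False y + op_coprod True y)
    + tensor_lift (\<lambda>x' x''. x' \<otimes> (x'' \<succ> y)) (op_coprod b x)
    + (if b then tensor_lift (\<lambda>y' y''. y' \<otimes> (x \<succ> y'')) (op_coprod False y + op_coprod True y)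
       else x \<otimes> y + tensor_lift (\<lambda>y' y''. (x \<star> y') \<otimes> y'') (op_coprod False y + op_coprod True y))"
  unfolding flip_S_ctotal[symmetric] unfolding op_coprod_def S_coprod_prec S_coprod_succ
  by (cases b; simp add: tensor_flip_add flip_tensor_lift_product bilinearQ_S_prec bilinearQ_S_succ
      bilinearQ_S_star flip_tensor_lift product_slots tensor_flip_tensor)+


theorem proposition15:
  shows "(\<forall>x y :: Splus.
      \<Delta>\<^sub>\<prec> (x \<prec> y) =
          tensor_lift (\<lambda>x' x''. tensor_lift (\<lambda>y' y''. (x' \<prec> y') \<otimes> (x'' \<star> y'')) (\<Delta> y)) (\<Delta>\<^sub>\<prec> x)
        + x \<otimes> y
        + tensor_lift (\<lambda>y' y''. (x \<prec> y') \<otimes> y'') (\<Delta> y)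
        + tensor_lift (\<lambda>x' x''. x' \<otimes> (x'' \<star> y)) (\<Delta>\<^sub>\<prec> x)
        + tensor_lift (\<lambda>x' x''. (x' \<prec> y) \<otimes> x'') (\<Delta>\<^sub>\<prec> x) \<and>
      \<Delta>\<^sub>\<succ> (x \<prec> y) =
          tensor_lift (\<lambda>x' x''. tensor_lift (\<lambda>y' y''. (x' \<prec> y') \<otimes> (x'' \<star> y'')) (\<Delta> y)) (\<Delta>\<^sub>\<succ> x)
        + tensor_lift (\<lambda>x' x''. (x' \<prec> y) \<otimes> x'') (\<Delta>\<^sub>\<succ> x)
        + tensor_lift (\<lambda>x' x''. x' \<otimes> (x'' \<star> y)) (\<Delta>\<^sub>\<succ> x) \<and>
      \<Delta>\<^sub>\<prec> (x \<succ> y) =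
          tensor_lift (\<lambda>x' x''. tensor_lift (\<lambda>y' y''. (x' \<succ> y') \<otimes> (x'' \<star> y'')) (\<Delta> y)) (\<Delta>\<^sub>\<prec> x)
        + tensor_lift (\<lambda>x' x''. (x' \<succ> y) \<otimes> x'') (\<Delta>\<^sub>\<prec> x)
        + tensor_lift (\<lambda>y' y''. (x \<succ> y') \<otimes> y'') (\<Delta> y) \<and>
      \<Delta>\<^sub>\<succ> (x \<succ> y) =
          tensor_lift (\<lambda>x' x''. tensor_lift (\<lambda>y' y''. (x' \<succ> y') \<otimes> (x'' \<star> y'')) (\<Delta> y)) (\<Delta>\<^sub>\<succ> x)
        + y \<otimes> x
        + tensor_lift (\<lambda>y' y''. y' \<otimes> (x \<star> y'')) (\<Delta> y)
        + tensor_lift (\<lambda>x' x''. (x' \<succ> y) \<otimes> x'') (\<Delta>\<^sub>\<succ> x))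
    \<and> bidendriform_bialgebra
        (\<lambda>a b :: Splus. b \<succ> a) (\<lambda>a b. b \<prec> a)
        (\<lambda>a. tensor_flip (\<Delta>\<^sub>\<succ> a)) (\<lambda>a. tensor_flip (\<Delta>\<^sub>\<prec> a))"
proof (intro conjI allI)
  fix x y :: Splus
  show "\<Delta>\<^sub>\<prec> (x \<prec> y) =
          tensor_lift (\<lambda>x' x''. tensor_lift (\<lambda>y' y''. (x' \<prec> y') \<otimes> (x'' \<star> y'')) (\<Delta> y)) (\<Delta>\<^sub>\<prec> x)
        + x \<otimes> y
        + tensor_lift (\<lambda>y' y''. (x \<prec> y') \<otimes> y'') (\<Delta> y)
        + tensor_lift (\<lambda>x' x''. x' \<otimes> (x'' \<star> y)) (\<Delta>\<^sub>\<prec> x)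
        + tensor_lift (\<lambda>x' x''. (x' \<prec> y) \<otimes> x'') (\<Delta>\<^sub>\<prec> x)"
    using S_coprod_prec[of True x y] by (simp add: S_coprod_def ac_simps)
  show "\<Delta>\<^sub>\<succ> (x \<prec> y) =
          tensor_lift (\<lambda>x' x''. tensor_lift (\<lambda>y' y''. (x' \<prec> y') \<otimes> (x'' \<star> y'')) (\<Delta> y)) (\<Delta>\<^sub>\<succ> x)
        + tensor_lift (\<lambda>x' x''. (x' \<prec> y) \<otimes> x'') (\<Delta>\<^sub>\<succ> x)
        + tensor_lift (\<lambda>x' x''. x' \<otimes> (x'' \<star> y)) (\<Delta>\<^sub>\<succ> x)"
    using S_coprod_prec[of False x y] by (simp add: S_coprod_def ac_simps)
  show "\<Delta>\<^sub>\<prec> (x \<succ> y) =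
          tensor_lift (\<lambda>x' x''. tensor_lift (\<lambda>y' y''. (x' \<succ> y') \<otimes> (x'' \<star> y'')) (\<Delta> y)) (\<Delta>\<^sub>\<prec> x)
        + tensor_lift (\<lambda>x' x''. (x' \<succ> y) \<otimes> x'') (\<Delta>\<^sub>\<prec> x)
        + tensor_lift (\<lambda>y' y''. (x \<succ> y') \<otimes> y'') (\<Delta> y)"
    using S_coprod_succ[of True x y] by (simp add: S_coprod_def ac_simps)
  show "\<Delta>\<^sub>\<succ> (x \<succ> y) =
          tensor_lift (\<lambda>x' x''. tensor_lift (\<lambda>y' y''. (x' \<succ> y') \<otimes> (x'' \<star> y'')) (\<Delta> y)) (\<Delta>\<^sub>\<succ> x)
        + y \<otimes> x
        + tensor_lift (\<lambda>y' y''. y' \<otimes> (x \<star> y'')) (\<Delta> y)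
        + tensor_lift (\<lambda>x' x''. (x' \<succ> y) \<otimes> x'') (\<Delta>\<^sub>\<succ> x)"
    using S_coprod_succ[of False x y] by (simp add: S_coprod_def ac_simps)
next
  have op: "(\<lambda>a. tensor_flip (\<Delta>\<^sub>\<succ> a)) = op_coprod False" "(\<lambda>a. tensor_flip (\<Delta>\<^sub>\<prec> a)) = op_coprod True"
    by (simp_all add: fun_eq_iff op_coprod_def S_coprod_def)
  have star: "b \<succ> a + b \<prec> a = b \<star> a" for a b :: Splus
    by (simp add: S_star_def add.commute)
  show "bidendriform_bialgebra (\<lambda>a b :: Splus. b \<succ> a) (\<lambda>a b. b \<prec> a)
      (\<lambda>a. tensor_flip (\<Delta>\<^sub>\<succ> a)) (\<lambda>a. tensor_flip (\<Delta>\<^sub>\<prec> a))"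
    unfolding op
  proof (unfold_locales, unfold star)
    show "bilinearQ (\<lambda>a b :: Splus. b \<succ> a)" "bilinearQ (\<lambda>a b :: Splus. b \<prec> a)"
      by (simp_all add: bilinearQ_iff product_bilinear)
  qed (simp_all add: linearQ_op_coprod[unfolded linearQ_iff] S_prec_prec S_succ_prec S_star_succ
      op_coassoc_total_right op_coassoc_mixed op_coassoc_total_left op_coprod_prec op_coprod_succ ac_simps)
qed

end
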